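(* Let $\alpha\in[0,1]$, $\beta=\sqrt{1-\alpha^2}$, $c_0>0$, and let $\{\vec m_{c_0,\alpha},\vec n_{c_0,\alpha},\vec b_{c_0,\alpha}\}$ be the solution of the Serret--Frenet system $$\vec m'=c\,\vec n,\qquad \vec n'=-c\,\vec m+\tau\,\vec b,\qquad \vec b'=-\tau\,\vec n,$$ on $\mathbb R$ with $c(s)=c_0e^{-\alpha s^2/4}$, $\tau(s)=\beta s/2$ and $\vec m(0)=(1,0,0)$, $\vec n(0)=(0,1,0)$, $\vec b(0)=(0,0,1)$. Then: (i) (Symmetries) $m_{1,c_0,\alpha}$ is an even function and $m_{j,c_0,\alpha}$ is an odd function for $j\in\{2,3\}$; $n_{1,c_0,\alpha}$ and $b_{1,c_0,\alpha}$ are odd functions, while $n_{j,c_0,\alpha}$ and $b_{j,c_0,\alpha}$ are even functions for $j\in\{2,3\}$. (ii) (Asymptotics) There exist a unit vector $\vec A^+_{c_0,\alpha}\in\mathbb S^2$ and $\vec B^+_{c_0,\alpha}\in\mathbb R^3$ such that the following asymptotics hold for all $s\ge s_0=4\sqrt{8+c_0^2}$: $$\vec m_{c_0,\alpha}(s)=\vec A^+_{c_0,\alpha}-\frac{2c_0}{s}\vec B^+_{c_0,\alpha}e^{-\alpha s^2/4}\big(\alpha\sin(\vec\phi(s))+\beta\cos(\vec\phi(s))\big)-\frac{2c_0^2}{s^2}\vec A^+_{c_0,\alpha}e^{-\alpha s^2/2}+O\left(\frac{e^{-\alpha s^2/4}}{s^3}\right),$$ $$\vec n_{c_0,\alpha}(s)=\vec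 B^+_{c_0,\alpha}\sin(\vec\phi(s))+\frac{2c_0}{s}\vec A^+_{c_0,\alpha}\,\alpha\, e^{-\alpha s^2/4}+O\left(\frac{e^{-\alpha s^2/4}}{s^2}\right),$$ $$\vec b_{c_0,\alpha}(s)=\vec B^+_{c_0,\alpha}\cos(\vec\phi(s))+\frac{2c_0}{s}\vec A^+_{c_0,\alpha}\,\beta\, e^{-\alpha s^2/4}+O\left(\frac{e^{-\alpha s^2/4}}{s^2}\right).$$ Here $\vec\phi=(\phi_1,\phi_2,\phi_3)$ with $$\phi_j(s)=a_j+\beta\int_{s_0^2/4}^{s^2/4}\sqrt{1+c_0^2\frac{e^{-2\alpha\sigma}}{\sigma}}\,d\sigma,\qquad j\in\{1,2,3\},$$ for some constants $a_1,a_2,a_3\in[0,2\pi)$, and $\vec B^+_{c_0,\alpha}$ is given in terms of $\vec A^+_{c_0,\alpha}=(A^+_{j,c_0,\alpha})_{j=1}^3$ by $$\vec B^+_{c_0,\alpha}=\big((1-(A^+_{1,c_0,\alpha})^2)^{1/2},(1-(A^+_{2,c_0,\alpha})^2)^{1/2},(1-(A^+_{3,c_0,\alpha})^2)^{1/2}\big).$$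
   Context: Subscripts $1,2,3$ denote the components of a vector of $\mathbb R^3$. $\sin(\vec\phi)$ and $\cos(\vec\phi)$ act componentwise, and products such as $\vec B^+\sin(\vec\phi)$ are taken componentwise, i.e. the $j$-th component is $B_j^+\sin(\phi_j)$. Notation $O$: $O(g(s))$ denotes a (vector-valued) function for which there is a constant $C(c_0)>0$, depending on $c_0$ but independent of $\alpha\in[0,1]$, such that $|O(g(s))|\le C(c_0)|g(s)|$ for all $s\ge s_0$. *)

theory Defs
  imports "HOL-Analysis.Analysis"
begin

definition serret_frenet ::
  "(real \<Rightarrow> real) \<Rightarrow> (real \<Rightarrow> real) \<Rightarrow>
   (real \<Rightarrow> real^3) \<Rightarrow> (real \<Rightarrow> real^3) \<Rightarrow> (real \<Rightarrow> real^3) \<Rightarrow> bool"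
where
  "serret_frenet c \<tau> m n b \<longleftrightarrow>
     (\<forall>s. (m has_vector_derivative c s *\<^sub>R n s) (at s)) \<and>
     (\<forall>s. (n has_vector_derivative - (c s *\<^sub>R m s) + \<tau> s *\<^sub>R b s) (at s)) \<and>
     (\<forall>s. (b has_vector_derivative - (\<tau> s *\<^sub>R n s)) (at s))"

definition beta :: "real \<Rightarrow> real" where
  "beta \<alpha> = sqrt (1 - \<alpha>\<^sup>2)"

definition profile_solution ::
  "real \<Rightarrow> real \<Rightarrow>
   (real \<Rightarrow> real^3) \<Rightarrow> (real \<Rightarrow> real^3) \<Rightarrow> (real \<Rightarrow> real^3) \<Rightarrow> bool"
where
  "profile_solution c0 \<alpha> m n b \<longleftrightarrow>
     serret_frenet (\<lambda>s. c0 * exp (- \<alpha> * s\<^sup>2 / 4)) (\<lambda>s. beta \<alpha> * s / 2) m n b \<and>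
     m 0 = vector [1, 0, 0] \<and> n 0 = vector [0, 1, 0] \<and> b 0 = vector [0, 0, 1]"

definition even_fun :: "(real \<Rightarrow> real) \<Rightarrow> bool" where
  "even_fun f \<longleftrightarrow> (\<forall>s. f (- s) = f s)"

definition odd_fun :: "(real \<Rightarrow> real) \<Rightarrow> bool" where
  "odd_fun f \<longleftrightarrow> (\<forall>s. f (- s) = - f s)"

definition s0 :: "real \<Rightarrow> real" where
  "s0 c0 = 4 * sqrt (8 + c0\<^sup>2)"

text \<open>Only used for \<open>s \<ge> s0 c0\<close>, where the set integral below is the oriented integral
  from \<open>(s0 c0)\<^sup>2 / 4\<close> to \<open>s\<^sup>2 / 4\<close>.\<close>

definition phase :: "real \<Rightarrow> real \<Rightarrow> real^3 \<Rightarrow> real \<Rightarrow> real^3" where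
  "phase c0 \<alpha> a s =
     (\<chi> j. a $ j + beta \<alpha> *
        integral {(s0 c0)\<^sup>2 / 4 .. s\<^sup>2 / 4} (\<lambda>\<sigma>. sqrt (1 + c0\<^sup>2 * (exp (- 2 * \<alpha> * \<sigma>) / \<sigma>))))"

definition vsin :: "real^3 \<Rightarrow> real^3" where
  "vsin v = (\<chi> j. sin (v $ j))"

definition vcos :: "real^3 \<Rightarrow> real^3" where
  "vcos v = (\<chi> j. cos (v $ j))"

definition Bplus :: "real^3 \<Rightarrow> real^3" where
  "Bplus A = (\<chi> j. sqrt (1 - (A $ j)\<^sup>2))"

text \<open>\<open>bigO_from C t g f h\<close> says \<open>f = h + O(g)\<close> on \<open>[t, \<infinity>)\<close> with constant \<open>C\<close>.
  The constant is an explicit argument so that its uniformity in \<open>\<alpha>\<close> is expressed by the order of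
  the quantifiers.\<close>

definition bigO_from ::
  "real \<Rightarrow> real \<Rightarrow> (real \<Rightarrow> real) \<Rightarrow> (real \<Rightarrow> real^3) \<Rightarrow> (real \<Rightarrow> real^3) \<Rightarrow> bool"
where
  "bigO_from C t g f h \<longleftrightarrow> (\<forall>s\<ge>t. norm (f s - h s) \<le> C * \<bar>g s\<bar>)"

end

theory Submission imports Defs begin

text \<open>Fix a coordinate and write \<open>(m, n, b)\<close> for the corresponding row of the frame. It solves a linear
  system which conserves the Euclidean inner product of two solutions. Conservation gives uniqueness, hence
  the symmetries, because reflecting \<open>s\<close> (with signs) maps rows to rows. It also makes the matrix of the frame
  orthogonal, so that each row and each column has norm one.

  For the asymptotics let \<open>z = b + \<i> n\<close>, so that \<open>z' = \<i>\<tau>z - \<i>cm\<close> and \<open>m' = cn\<close>, where \<open>c\<close> and \<open>\<tau>\<close> are the curvature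
  and the torsion. As \<open>z\<close> rotates at the rate \<open>\<tau> = \<beta>s/2\<close> and \<open>c\<close> has the logarithmic derivative \<open>- \<alpha>s/2\<close>, products
  such as \<open>c z\<close> vary like \<open>exp ((- \<alpha> + \<i>\<beta>) s\<^sup>2 / 4)\<close>. Integration by parts thus divides by \<open>(- \<alpha> + \<i>\<beta>) s / 2\<close>, of
  modulus \<open>s / 2\<close> because \<open>\<alpha>\<^sup>2 + \<beta>\<^sup>2 = 1\<close>: it gains a factor \<open>1 / s\<close> uniformly in \<open>\<alpha>\<close>, decay taking over
  where oscillation fails. This is the reason why the constants depend on \<open>c0\<close> only.

  The integrations by parts are carried out on derivatives: explicit correctors are added to \<open>m\<close> and to
  \<open>z\<close> until the derivative of the sum is bounded by a constant times \<open>- G'\<close>, where \<open>G = c / s\<^sup>3\<close> for \<open>m\<close> and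
  \<open>G = c / s\<^sup>2\<close> for \<open>z\<close>. Then \<open>limit_with_rate\<close> yields a limit, approached at the rate \<open>G\<close>. Since \<open>- G'\<close> contains
  the summand \<open>\<alpha> s G / 2\<close>, large error terms are admissible if they have a factor \<open>\<alpha>\<close>, and the correctors
  (in \<open>corrected_m\<close> and \<open>corrected_z\<close>) are chosen so that precisely such terms remain.

  For \<open>m\<close> the limit is the component of \<open>A\<close>. For \<open>z\<close> the factor \<open>exp (- \<i>\<phi>)\<close> is split off first. The corrector
  \<open>- 2 (\<beta> + \<i>\<alpha>) c m / s\<close> of \<open>z\<close> feeds back on \<open>z\<close> through \<open>m'\<close>, and among the terms so produced only \<open>\<i>\<beta>c\<^sup>2 z / s\<close> neither oscillates nor
  carries a factor \<open>\<alpha>\<close>; this is the shift of the rotation rate which the square root in the phase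
  accounts for, up to \<open>c\<^sup>4 / s\<^sup>3\<close> by \<open>phase_rate_expansion\<close>. The limit \<open>W\<close> of the corrected, unwound \<open>z\<close> has modulus
  \<open>sqrt (1 - A\<^sup>2)\<close>, because \<open>\<bar>z\<bar>\<^sup>2 = 1 - m\<^sup>2\<close>, and its argument is the constant \<open>a\<close>. Nothing is divided by the modulus
  of \<open>W\<close>, so that components with \<open>A = 1\<close> or \<open>A = - 1\<close> are no special case.\<close>

section \<open>Limits approached at a prescribed rate\<close>

text \<open>By the mean value inequality the increments of \<open>F\<close> are at most \<open>K\<close> times those of \<open>- G\<close>, so \<open>F\<close> is Cauchy
  at infinity, and letting the right endpoint tend to infinity bounds the distance to the limit.\<close>

lemma limit_with_rate:
  fixes F :: "real \<Rightarrow> 'a::banach" and G :: "real \<Rightarrow> real"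
  assumes dF: "\<And>s. s \<ge> t \<Longrightarrow> (F has_vector_derivative F' s) (at s)"
    and dG: "\<And>s. s \<ge> t \<Longrightarrow> (G has_real_derivative - D s) (at s)"
    and bound: "\<And>s. s \<ge> t \<Longrightarrow> norm (F' s) \<le> K * D s"
    and K: "K \<ge> 0" and G_nonneg: "\<And>s. s \<ge> t \<Longrightarrow> G s \<ge> 0" and G: "(G \<longlongrightarrow> 0) at_top"
  obtains L where "(F \<longlongrightarrow> L) at_top" "\<And>s. s \<ge> t \<Longrightarrow> norm (F s - L) \<le> K * G s"
proof -
  have increment: "norm (F y - F x) \<le> K * G x" if "t \<le> x" "x \<le> y" for x y
  proof (cases "x = y")
    case False
    have "norm (F y - F x) \<le> (- K * G y) - (- K * G x)"
    proof (rule differentiable_bound_general[where f' = F' and \<phi>' = "\<lambda>s. K * D s"])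
      show "x < y" using that False by simp
      show "continuous_on {x..y} F"
        using that has_vector_derivative_continuous[OF dF]
        by (intro continuous_at_imp_continuous_on) auto
      have "isCont G s" if "s \<ge> t" for s using dG[OF that] by (rule DERIV_isCont)
      then show "continuous_on {x..y} (\<lambda>s. - K * G s)"
        using that by (intro continuous_intros continuous_at_imp_continuous_on) auto
      show "((\<lambda>s. - K * G s) has_vector_derivative K * D s) (at s)" if "x < s" "s < y" for s
        using DERIV_cmult[OF dG[of s], of "- K"] that \<open>t \<le> x\<close>
        by (simp add: has_real_derivative_iff_has_vector_derivative)
    qed (use that dF bound in auto)
    moreover have "K * G y \<ge> 0" using that K G_nonneg by simp
    ultimately show ?thesis by simp
  qed (use K G_nonneg that in simp)
  have KG: "((\<lambda>s. K * G s) \<longlongrightarrow> 0) at_top"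
    using tendsto_mult_right_zero[OF G] .
  have "Cauchy (\<lambda>k. F (real k))"
  proof (rule metric_CauchyI)
    fix e :: real assume "e > 0"
    then have "\<forall>\<^sub>F s in at_top. K * G s < e / 2"
      using order_tendstoD(2)[OF KG, of "e / 2"] by simp
    then obtain N0 where N0: "\<And>s. s \<ge> N0 \<Longrightarrow> K * G s < e / 2"
      unfolding eventually_at_top_linorder by auto
    define N where "N = nat \<lceil>max N0 t\<rceil>"
    have N: "real N \<ge> N0" "real N \<ge> t" unfolding N_def by linarith+
    have near: "dist (F (real k)) (F (real N)) < e / 2" if "k \<ge> N" for k
      using increment[of "real N" "real k"] N0[of "real N"] N that by (simp add: dist_norm)
    show "\<exists>M. \<forall>k\<ge>M. \<forall>l\<ge>M. dist (F (real k)) (F (real l)) < e"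
      using dist_triangle_half_l[OF near near] by (metis dist_commute near dist_triangle_half_l)
  qed
  then obtain L where L: "(\<lambda>k. F (real k)) \<longlonglongrightarrow> L"
    using Cauchy_convergent convergent_def by blast
  have rate: "norm (F s - L) \<le> K * G s" if "s \<ge> t" for s
  proof (rule tendsto_upperbound)
    show "(\<lambda>k. norm (F s - F (real k))) \<longlonglongrightarrow> norm (F s - L)"
      by (intro tendsto_intros L)
    show "\<forall>\<^sub>F k in sequentially. norm (F s - F (real k)) \<le> K * G s"
      using eventually_ge_at_top[of "nat \<lceil>s\<rceil>"]
    proof eventually_elim
      case (elim k)
      then have "s \<le> real k" by linarith
      then show ?case using increment[OF \<open>t \<le> s\<close>, of "real k"] by (simp add: norm_minus_commute)
    qed
  qed simp
  have "((\<lambda>s. F s - L) \<longlongrightarrow> 0) at_top"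
    by (rule Lim_null_comparison[OF _ KG])
      (use rate in \<open>auto simp: eventually_at_top_linorder\<close>)
  then have "(F \<longlongrightarrow> L) at_top" by (simp add: LIM_zero_iff)
  with rate that show thesis by blast
qed

section \<open>Rows of the Serret-Frenet frame\<close>

definition row_ode :: "(real \<Rightarrow> real) \<Rightarrow> (real \<Rightarrow> real) \<Rightarrow>
    (real \<Rightarrow> real) \<Rightarrow> (real \<Rightarrow> real) \<Rightarrow> (real \<Rightarrow> real) \<Rightarrow> bool"
where
  "row_ode c \<tau> m n b \<longleftrightarrow>
     (\<forall>s. (m has_real_derivative c s * n s) (at s)) \<and>
     (\<forall>s. (n has_real_derivative - (c s * m s) + \<tau> s * b s) (at s)) \<and>
     (\<forall>s. (b has_real_derivative - (\<tau> s * n s)) (at s))"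

lemma row_odeD:
  assumes "row_ode c \<tau> m n b"
  shows "(m has_real_derivative c s * n s) (at s)"
    and "(n has_real_derivative - (c s * m s) + \<tau> s * b s) (at s)"
    and "(b has_real_derivative - (\<tau> s * n s)) (at s)"
  using assms by (auto simp: row_ode_def)

lemma row_ode_component:
  assumes "serret_frenet c \<tau> m n b"
  shows "row_ode c \<tau> (\<lambda>s. m s $ j) (\<lambda>s. n s $ j) (\<lambda>s. b s $ j)"
proof -
  have comp: "((\<lambda>s. f s $ j) has_real_derivative f' $ j) (at s)"
    if "(f has_vector_derivative f') (at s)" for f :: "real \<Rightarrow> real^3" and f' s
    using bounded_linear.has_vector_derivative[OF bounded_linear_vec_nth that]
    by (simp add: has_real_derivative_iff_has_vector_derivative)
  have "((\<lambda>s. m s $ j) has_real_derivative (c s *\<^sub>R n s) $ j) (at s)"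
    "((\<lambda>s. n s $ j) has_real_derivative (- (c s *\<^sub>R m s) + \<tau> s *\<^sub>R b s) $ j) (at s)"
    "((\<lambda>s. b s $ j) has_real_derivative (- (\<tau> s *\<^sub>R n s)) $ j) (at s)" for s
    by (rule comp; use assms in \<open>simp add: serret_frenet_def\<close>)+
  then show ?thesis by (simp add: row_ode_def)
qed

lemma row_ode_inner_product:
  assumes "row_ode c \<tau> m n b" "row_ode c \<tau> m' n' b'"
  shows "m s * m' s + n s * n' s + b s * b' s = m 0 * m' 0 + n 0 * n' 0 + b 0 * b' 0"
proof -
  have "((\<lambda>s. m s * m' s + n s * n' s + b s * b' s) has_real_derivative 0) (at s)" for s
    by (rule derivative_eq_intros row_odeD[OF assms(1)] row_odeD[OF assms(2)] refl)+
      (simp add: algebra_simps)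
  then show ?thesis
    by (intro DERIV_isconst_all allI)
qed

text \<open>The difference of the two solutions is a solution whose norm is constant and vanishes at \<open>0\<close>.\<close>

lemma row_ode_unique:
  assumes "row_ode c \<tau> m n b" "row_ode c \<tau> m' n' b'"
    and "m 0 = m' 0" "n 0 = n' 0" "b 0 = b' 0"
  shows "m s = m' s" "n s = n' s" "b s = b' s"
proof -
  have "row_ode c \<tau> (\<lambda>s. m s - m' s) (\<lambda>s. n s - n' s) (\<lambda>s. b s - b' s)"
    unfolding row_ode_def
    using DERIV_diff[OF row_odeD(1)[OF assms(1)] row_odeD(1)[OF assms(2)]]
      DERIV_diff[OF row_odeD(2)[OF assms(1)] row_odeD(2)[OF assms(2)]]
      DERIV_diff[OF row_odeD(3)[OF assms(1)] row_odeD(3)[OF assms(2)]]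
    by (simp add: algebra_simps)
  from row_ode_inner_product[OF this this, of s]
  have "(m s - m' s)\<^sup>2 + (n s - n' s)\<^sup>2 + (b s - b' s)\<^sup>2 = 0"
    using assms by (simp add: power2_eq_square)
  then show "m s = m' s" "n s = n' s" "b s = b' s"
    by (simp_all add: add_nonneg_eq_0_iff)
qed

text \<open>Reversing \<open>s\<close> changes the sign of the derivative and of the torsion, but not of the curvature; the signs
  given to the reflected \<open>n\<close> and \<open>b\<close> compensate for both. The factor \<open>\<epsilon>\<close> covers the even and the odd case.\<close>

lemma row_ode_reflection:
  assumes ode: "row_ode c \<tau> m n b" and c: "\<And>s. c (- s) = c s" and \<tau>: "\<And>s. \<tau> (- s) = - \<tau> s"
    and init: "\<epsilon> * m 0 = m 0" "- (\<epsilon> * n 0) = n 0" "- (\<epsilon> * b 0) = b 0"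
  shows "m s = \<epsilon> * m (- s)" "n s = - (\<epsilon> * n (- s))" "b s = - (\<epsilon> * b (- s))"
proof -
  have flip: "((\<lambda>s. f (- s)) has_real_derivative - f' (- s)) (at s)"
    if "(f has_real_derivative f' (- s)) (at (- s))" for f f' :: "real \<Rightarrow> real" and s
    using that DERIV_mirror[of f "f' (- s)" s] by simp
  note flip_ode = flip[of m "\<lambda>s. c s * n s", OF row_odeD(1)[OF ode]]
    flip[of n "\<lambda>s. - (c s * m s) + \<tau> s * b s", OF row_odeD(2)[OF ode]]
    flip[of b "\<lambda>s. - (\<tau> s * n s)", OF row_odeD(3)[OF ode]]
  have "row_ode c \<tau> (\<lambda>s. \<epsilon> * m (- s)) (\<lambda>s. - (\<epsilon> * n (- s))) (\<lambda>s. - (\<epsilon> * b (- s)))"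
    unfolding row_ode_def
    using DERIV_cmult[OF flip_ode(1), of \<epsilon>] DERIV_minus[OF DERIV_cmult[OF flip_ode(2), of \<epsilon>]]
      DERIV_minus[OF DERIV_cmult[OF flip_ode(3), of \<epsilon>]]
    by (simp add: c \<tau> algebra_simps)
  note unique = row_ode_unique[OF ode this]
  show "m s = \<epsilon> * m (- s)" "n s = - (\<epsilon> * n (- s))" "b s = - (\<epsilon> * b (- s))"
    by (rule unique; simp add: init)+
qed

section \<open>Asymptotics of the tangent component\<close>

lemma beta_bounds:
  assumes "0 \<le> \<alpha>" "\<alpha> \<le> 1"
  shows "0 \<le> beta \<alpha>" "beta \<alpha> \<le> 1" "\<alpha>\<^sup>2 + (beta \<alpha>)\<^sup>2 = 1"
  using assms by (auto simp: beta_def abs_square_le_1)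

lemma abs_mult_le_mult:
  fixes x y B :: real
  assumes "0 \<le> x" "\<bar>y\<bar> \<le> B"
  shows "\<bar>x * y\<bar> \<le> x * B"
  using assms by (simp add: abs_mult mult_left_mono)

lemma abs_mult_le_of_le_one:
  fixes u x B :: real
  assumes "0 \<le> u" "u \<le> 1" "\<bar>x\<bar> \<le> B"
  shows "\<bar>u * x\<bar> \<le> B"
  using mult_mono[of u 1 "\<bar>x\<bar>" B] assms by (simp add: abs_mult)

lemma monomial_bound:
  fixes c r k :: real
  assumes "0 \<le> c" "c \<le> k" "1 \<le> k" "0 \<le> r" "r \<le> 1" "j \<le> N" "q \<le> p"
  shows "c ^ Suc j * r ^ p \<le> k ^ N * (c * r ^ q)"
proof -
  have "c ^ j \<le> k ^ N"
    using assms by (meson power_increasing power_mono order_trans)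
  moreover have "r ^ p \<le> r ^ q"
    using assms by (simp add: power_decreasing)
  ultimately have "c ^ j * r ^ p \<le> k ^ N * r ^ q"
    using assms by (intro mult_mono) auto
  then show ?thesis
    using mult_left_mono[of _ _ c] assms(1) by (fastforce simp: algebra_simps)
qed

locale frenet_row =
  fixes c0 \<alpha> :: real and m n b :: "real \<Rightarrow> real"
  assumes c0: "c0 > 0" and \<alpha>: "0 \<le> \<alpha>" "\<alpha> \<le> 1"
    and ode: "row_ode (\<lambda>s. c0 * exp (- \<alpha> * s\<^sup>2 / 4)) (\<lambda>s. beta \<alpha> * s / 2) m n b"
    and unit: "\<And>s. (m s)\<^sup>2 + (n s)\<^sup>2 + (b s)\<^sup>2 = 1"
begin

abbreviation \<beta> :: real where "\<beta> \<equiv> beta \<alpha>"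

definition c :: "real \<Rightarrow> real" where "c s = c0 * exp (- \<alpha> * s\<^sup>2 / 4)"

text \<open>The constant \<open>k\<close> exceeds both \<open>1\<close> and the curvature, so that every monomial in the curvature is at most a
  power of \<open>k\<close>; all constants below are numerical multiples of powers of \<open>k\<close>, hence independent of \<open>\<alpha>\<close>.\<close>

abbreviation k :: real where "k \<equiv> 1 + c0"

lemma dm: "(m has_real_derivative c s * n s) (at s)"
  and dn: "(n has_real_derivative - (c s * m s) + \<beta> * s / 2 * b s) (at s)"
  and db: "(b has_real_derivative - (\<beta> * s / 2 * n s)) (at s)"
  using row_odeD[OF ode, of s] by (simp_all add: c_def)

lemma dc: "(c has_real_derivative - (\<alpha> * s / 2 * c s)) (at s)"
  unfolding c_def [abs_def] by (auto intro!: derivative_eq_intros)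

lemma c_pos: "c s > 0" and c_le: "c s \<le> c0"
  using c0 \<alpha> by (auto simp: c_def)

lemma entry_bounds: "\<bar>m s\<bar> \<le> 1" "\<bar>n s\<bar> \<le> 1" "\<bar>b s\<bar> \<le> 1"
proof -
  have "(m s)\<^sup>2 \<le> 1" "(n s)\<^sup>2 \<le> 1" "(b s)\<^sup>2 \<le> 1"
    using unit[of s] zero_le_power2[of "m s"] zero_le_power2[of "n s"] zero_le_power2[of "b s"]
    by linarith+
  then show "\<bar>m s\<bar> \<le> 1" "\<bar>n s\<bar> \<le> 1" "\<bar>b s\<bar> \<le> 1" by (simp_all add: abs_square_le_1)
qed

definition r :: "real \<Rightarrow> real" where "r s = 1 / s"

lemma dr: "s > 0 \<Longrightarrow> (r has_real_derivative - (r s ^ 2)) (at s)"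
  unfolding r_def[abs_def] by (auto intro!: derivative_eq_intros simp: power2_eq_square)

lemma r_bounds: "s \<ge> 1 \<Longrightarrow> 0 < r s" "s \<ge> 1 \<Longrightarrow> r s \<le> 1" "s > 0 \<Longrightarrow> s * r s = 1"
  by (auto simp: r_def)

lemma c_r_bounds:
  assumes "s \<ge> 1"
  shows "0 \<le> c s" "0 \<le> r s" "r s \<le> 1" "c s \<le> k" "1 \<le> k"
  using assms c_pos[of s] c_le[of s] c0 by (auto simp: r_def)

lemma c_r_monomial_bound:
  assumes "s \<ge> 1" "j \<le> N" "l \<le> p"
  shows "c s ^ Suc j * r s ^ p \<le> k ^ N * (c s * r s ^ l)"
  using c_r_bounds[OF assms(1)] assms by (intro monomial_bound) auto

text \<open>The rate at which \<open>c / s ^ (p + 1)\<close> decays contains \<open>\<alpha> * c / s ^ p\<close>, a whole power of \<open>s\<close> more than the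
  function itself. Error terms of this size are therefore integrable at no loss provided they carry a
  factor \<open>\<alpha>\<close>; the others have to be of size \<open>c / s ^ (p + 2)\<close>.\<close>

lemma dcr:
  assumes "s > 0"
  shows "((\<lambda>s. c s * r s ^ Suc p) has_real_derivative
    - (c s * (\<alpha> / 2 * r s ^ p + real (Suc p) * r s ^ (p + 2)))) (at s)"
proof -
  have "- (\<alpha> * s / 2 * c s) * r s ^ Suc p + real (Suc p) * (- (r s ^ 2) * r s ^ p) * c s
      = - (c s * (\<alpha> / 2 * (s * r s) * r s ^ p + real (Suc p) * r s ^ (p + 2)))"
    by (simp add: algebra_simps power2_eq_square)
  then show ?thesis
    using DERIV_mult[OF dc DERIV_power[OF dr[OF assms], of "Suc p"]]
    by (simp add: r_bounds(3)[OF assms])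
qed

lemma cr_tendsto_0: "((\<lambda>s. c s * r s ^ Suc p) \<longlongrightarrow> 0) at_top"
proof (rule Lim_null_comparison)
  have "(r \<longlongrightarrow> 0) at_top"
    unfolding r_def[abs_def] using tendsto_inverse_0_at_top[OF filterlim_ident]
    by (simp add: inverse_eq_divide)
  then have "((\<lambda>s. c0 * r s ^ Suc p) \<longlongrightarrow> c0 * 0 ^ Suc p) at_top"
    by (intro tendsto_intros)
  then show "((\<lambda>s. c0 * r s ^ Suc p) \<longlongrightarrow> 0) at_top" by simp
  show "\<forall>\<^sub>F s in at_top. norm (c s * r s ^ Suc p) \<le> c0 * r s ^ Suc p"
    using eventually_ge_at_top[of 1]
  proof eventually_elim
    case (elim s)
    then show ?case
      using c_pos[of s] c_le[of s] r_bounds[of s] by (auto simp: abs_mult intro!: mult_right_mono)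
  qed
qed

text \<open>With \<open>z = b + \<i> n\<close>, the functions \<open>Q\<close> and \<open>P\<close> are the real and imaginary parts of \<open>(\<alpha> + \<i>\<beta>) z\<close>.\<close>

definition P :: "real \<Rightarrow> real" where "P s = \<alpha> * n s + \<beta> * b s"

definition Q :: "real \<Rightarrow> real" where "Q s = \<alpha> * b s - \<beta> * n s"

lemma P_Q_bounds: "\<bar>P s\<bar> \<le> 2" "\<bar>Q s\<bar> \<le> 2" "\<bar>\<alpha> * P s + \<beta> * Q s\<bar> \<le> 4"
proof -
  note shrink = abs_mult_le_of_le_one[OF \<alpha>] abs_mult_le_of_le_one[OF beta_bounds(1,2)[OF \<alpha>]]
  show PQ: "\<bar>P s\<bar> \<le> 2" "\<bar>Q s\<bar> \<le> 2"
    unfolding P_def Q_def using shrink[OF entry_bounds(2)[of s]] shrink[OF entry_bounds(3)[of s]]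
    by linarith+
  show "\<bar>\<alpha> * P s + \<beta> * Q s\<bar> \<le> 4"
    using shrink(1)[OF PQ(1)] shrink(2)[OF PQ(2)] by linarith
qed

text \<open>The system says \<open>c z = - 2 (\<alpha> + \<i>\<beta>) ((c z / s)' + c z / s\<^sup>2 + \<i> c\<^sup>2 m / s)\<close>. The imaginary part of the left-hand side
  is \<open>m'\<close>, and substituting the identity into its own error terms gives the correctors below. The terms in
  \<open>c\<^sup>2 m / s\<close> produced on the way combine with \<open>(c\<^sup>2 m / s\<^sup>2)'\<close>; what is left of them at order \<open>c\<^sup>2 m / s\<^sup>3\<close> has
  a coefficient proportional to \<open>1 + \<alpha>\<^sup>2 - \<beta>\<^sup>2 = 2 \<alpha>\<^sup>2\<close> and is therefore admissible.\<close>

definition corrected_m :: "real \<Rightarrow> real" where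
  "corrected_m s = m s + 2 * (c s * r s * P s) - 2 * (c s ^ 2 * r s ^ 2 * m s)
     - 4 * (c s * r s ^ 3 * (\<alpha> * P s + \<beta> * Q s)) - 4 * (c s ^ 3 * r s ^ 3 * P s)"

definition corrected_m' :: "real \<Rightarrow> real" where
  "corrected_m' s = 8 * \<alpha>\<^sup>2 * c s ^ 2 * r s ^ 3 * m s + 12 * c s * r s ^ 4 * (\<alpha> * P s + \<beta> * Q s)
     + 4 * c s ^ 3 * (\<alpha> * r s ^ 2 + 3 * r s ^ 4) * P s + 4 * \<alpha> * c s ^ 4 * r s ^ 3 * m s"

lemma corrected_m_derivative:
  assumes "s > 0"
  shows "(corrected_m has_real_derivative corrected_m' s) (at s)"
proof -
  note * = beta_bounds(3)[OF \<alpha>] r_bounds(3)[OF assms]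
  show ?thesis
    unfolding corrected_m_def[abs_def] corrected_m'_def P_def Q_def
    apply (rule derivative_eq_intros dm dn db dc dr[OF assms] refl)+
    using *
    apply simp
    apply algebra
    done
qed

lemma corrected_m_derivative_bound:
  assumes s: "s \<ge> 1"
  shows "\<bar>corrected_m' s\<bar> \<le> 50 * k ^ 6 * (c s * (\<alpha> / 2 * r s ^ 2 + 3 * r s ^ 4))"
proof -
  note pos = c_r_bounds[OF s] and mb = c_r_monomial_bound[OF s, where N = 6]
  have T: "\<bar>8 * \<alpha>\<^sup>2 * c s ^ 2 * r s ^ 3 * m s\<bar> \<le> 8 * \<alpha>\<^sup>2 * c s ^ 2 * r s ^ 3 * 1"
    "\<bar>12 * c s * r s ^ 4 * (\<alpha> * P s + \<beta> * Q s)\<bar> \<le> 12 * c s * r s ^ 4 * 4"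
    "\<bar>4 * c s ^ 3 * (\<alpha> * r s ^ 2 + 3 * r s ^ 4) * P s\<bar> \<le> 4 * c s ^ 3 * (\<alpha> * r s ^ 2 + 3 * r s ^ 4) * 2"
    "\<bar>4 * \<alpha> * c s ^ 4 * r s ^ 3 * m s\<bar> \<le> 4 * \<alpha> * c s ^ 4 * r s ^ 3 * 1"
    by (rule abs_mult_le_mult; use pos \<alpha> entry_bounds P_Q_bounds in simp)+
  have mba: "\<alpha> * (c s ^ Suc j * r s ^ p) \<le> \<alpha> * (k ^ 6 * (c s * r s ^ l))" if "j \<le> 6" "l \<le> p" for j p l
    by (rule mult_left_mono[OF mb[OF that] \<alpha>(1)])
  have "\<alpha>\<^sup>2 * (c s ^ 2 * r s ^ 3) \<le> \<alpha> * (c s ^ 2 * r s ^ 3)"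
    using \<alpha> pos by (intro mult_right_mono) (auto simp: power2_eq_square mult_left_le)
  moreover have "\<dots> \<le> \<alpha> * (k ^ 6 * (c s * r s ^ 2))"
    using mba[of 1 2 3] by (simp add: numeral_2_eq_2)
  moreover have "0 \<le> \<alpha> * (k ^ 6 * (c s * r s ^ 2))" "0 \<le> k ^ 6 * (c s * r s ^ 4)"
    using pos \<alpha> by auto
  moreover have "12 * c s * r s ^ 4 * 4 \<le> 48 * (k ^ 6 * (c s * r s ^ 4))"
    using mb[of 0 4 4] by simp
  moreover have "4 * c s ^ 3 * (\<alpha> * r s ^ 2 + 3 * r s ^ 4) * 2
      = 8 * (\<alpha> * (c s ^ Suc 2 * r s ^ 2)) + 24 * (c s ^ Suc 2 * r s ^ 4)"
    by (simp add: algebra_simps eval_nat_numeral)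
  moreover have "4 * \<alpha> * c s ^ 4 * r s ^ 3 * 1 = 4 * (\<alpha> * (c s ^ Suc 3 * r s ^ 3))"
    by (simp add: eval_nat_numeral)
  moreover have "50 * k ^ 6 * (c s * (\<alpha> / 2 * r s ^ 2 + 3 * r s ^ 4))
      = 25 * (\<alpha> * (k ^ 6 * (c s * r s ^ 2))) + 150 * (k ^ 6 * (c s * r s ^ 4))"
    by (simp add: algebra_simps)
  ultimately show ?thesis
    unfolding corrected_m'_def using T mba[of 2 2 2] mb[of 2 4 4] mba[of 3 2 3] by linarith
qed

lemma tangent_limit:
  obtains A where "(m \<longlongrightarrow> A) at_top"
    "\<And>s. s \<ge> 1 \<Longrightarrow> \<bar>corrected_m s - A\<bar> \<le> 50 * k ^ 6 * (c s * r s ^ 3)"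
    "\<And>s. s \<ge> 1 \<Longrightarrow> \<bar>m s - A\<bar> \<le> 80 * k ^ 6 * (c s * r s)"
proof -
  have "\<exists>A. (corrected_m \<longlongrightarrow> A) at_top \<and>
      (\<forall>s\<ge>1. norm (corrected_m s - A) \<le> 50 * k ^ 6 * (c s * r s ^ 3))"
  proof (rule limit_with_rate)
    fix s :: real assume s: "s \<ge> 1"
    then have s0: "s > 0" by simp
    show "(corrected_m has_vector_derivative corrected_m' s) (at s)"
      using corrected_m_derivative[OF s0] by (simp add: has_real_derivative_iff_has_vector_derivative)
    show "((\<lambda>s. c s * r s ^ 3) has_real_derivative - (c s * (\<alpha> / 2 * r s ^ 2 + 3 * r s ^ 4))) (at s)"
      using dcr[OF s0, of 2] by (simp add: eval_nat_numeral)
    show "norm (corrected_m' s) \<le> 50 * k ^ 6 * (c s * (\<alpha> / 2 * r s ^ 2 + 3 * r s ^ 4))"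
      using corrected_m_derivative_bound[OF s] by simp
    show "0 \<le> c s * r s ^ 3" using c_pos[of s] r_bounds(1)[OF s] by simp
  next
    show "((\<lambda>s. c s * r s ^ 3) \<longlongrightarrow> 0) at_top"
      using cr_tendsto_0[of 2] by (simp add: eval_nat_numeral)
  qed (use c0 in auto)
  then obtain A where A: "(corrected_m \<longlongrightarrow> A) at_top"
    "\<And>s. s \<ge> 1 \<Longrightarrow> \<bar>corrected_m s - A\<bar> \<le> 50 * k ^ 6 * (c s * r s ^ 3)"
    by auto
  have near: "\<bar>m s - A\<bar> \<le> 80 * k ^ 6 * (c s * r s)" if s: "s \<ge> 1" for s
  proof -
    note pos = c_r_bounds[OF s]
    have T: "\<bar>c s * r s * P s\<bar> \<le> c s * r s * 2" "\<bar>c s ^ 2 * r s ^ 2 * m s\<bar> \<le> c s ^ 2 * r s ^ 2 * 1"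
      "\<bar>c s * r s ^ 3 * (\<alpha> * P s + \<beta> * Q s)\<bar> \<le> c s * r s ^ 3 * 4" "\<bar>c s ^ 3 * r s ^ 3 * P s\<bar> \<le> c s ^ 3 * r s ^ 3 * 2"
      by (rule abs_mult_le_mult; use pos entry_bounds P_Q_bounds in simp)+
    note mb = c_r_monomial_bound[OF s, where N = 6 and l = 1]
    have "c s * r s \<le> k ^ 6 * (c s * r s)" "c s ^ 2 * r s ^ 2 \<le> k ^ 6 * (c s * r s)"
      "c s * r s ^ 3 \<le> k ^ 6 * (c s * r s)" "c s ^ 3 * r s ^ 3 \<le> k ^ 6 * (c s * r s)"
      using mb[of 0 1] mb[of 1 2] mb[of 0 3] mb[of 2 3] by (simp_all add: eval_nat_numeral)
    moreover have "50 * k ^ 6 * (c s * r s ^ 3) \<le> 50 * k ^ 6 * (c s * r s)"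
      using pos power_decreasing[of 1 3 "r s"] by (intro mult_left_mono) auto
    ultimately show ?thesis
      using A(2)[OF s] T unfolding corrected_m_def by linarith
  qed
  have "(m \<longlongrightarrow> A) at_top"
  proof -
    have "((\<lambda>s. 80 * k ^ 6 * (c s * r s ^ Suc 0)) \<longlongrightarrow> 0) at_top"
      by (rule tendsto_mult_right_zero[OF cr_tendsto_0])
    then have "((\<lambda>s. m s - A) \<longlongrightarrow> 0) at_top"
      by (rule Lim_null_comparison[rotated])
        (use near in \<open>auto simp: eventually_at_top_linorder intro!: exI[of _ 1]\<close>)
    then show ?thesis by (simp add: LIM_zero_iff)
  qed
  with that A(2) near show thesis by blast
qed

end

section \<open>Algebra of the corrected normal components\<close>

text \<open>The part of the derivative of the corrected \<open>z\<close> which is not cancelled. In every summand, a power of \<open>r\<close>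
  less than the third is accompanied by a factor \<open>\<alpha>\<close> or by the phase error \<open>\<rho>\<close>, which is itself of third order.
  The arguments \<open>z\<close> and \<open>w\<close> stand for \<open>b + \<i> n\<close> and its conjugate, \<open>r\<close> for \<open>1 / s\<close>.\<close>

definition remainder ::
  "complex \<Rightarrow> complex \<Rightarrow> complex \<Rightarrow> complex \<Rightarrow> complex \<Rightarrow> complex \<Rightarrow> complex \<Rightarrow> complex \<Rightarrow> complex \<Rightarrow> complex \<Rightarrow> complex"
where
  "remainder q \<alpha> \<beta> c r \<rho> m n z w =
     - ((\<i> * \<rho> + \<alpha> * c\<^sup>2 * r) * z)
     - q\<^sup>2 * c\<^sup>2 * r\<^sup>2 * (\<i> * \<beta> * c\<^sup>2 * r + \<i> * \<rho> + 2 * r) * w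
     + (2 * \<i> * q * c * r * \<i> * \<rho>
        - (4 * \<i> * q\<^sup>2 * c + 2 * \<i> * q * c ^ 3) * r ^ 3 * (\<i> * \<beta> * c\<^sup>2 * r + \<i> * \<rho> + 3 * r)
        - 2 * \<i> * q * \<alpha> * c ^ 3 * r\<^sup>2) * m
     + (4 * \<i> * q\<^sup>2 * c + 2 * \<i> * q * c ^ 3) * r ^ 3 * c * n"

text \<open>A purely algebraic identity in which primed letters are the derivatives dictated by the system. Its left-hand
  side is the derivative of the corrected \<open>z\<close> minus \<open>\<i> \<phi>'\<close> times the corrected \<open>z\<close>, as it appears after the
  factor \<open>exp (- \<i>\<phi>)\<close> is split off. The correctors have the following origin. The forcing \<open>- \<i> c m\<close> is removed by the
  first one. At low order it leaves a multiple of \<open>c m / s\<^sup>2\<close> (from differentiating \<open>1 / s\<close>) and, through \<open>m'\<close> and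
  the shifted phase rate, multiples of \<open>c\<^sup>2 w / s\<close>, with \<open>w\<close> the conjugate of \<open>z\<close>, and of \<open>c\<^sup>3 m / s\<^sup>2\<close>. Multiplied by
  \<open>exp (- \<i>\<phi>)\<close>, these three still oscillate or decay at a rate proportional to \<open>s\<close>, and the other three correctors
  remove them.\<close>

lemma corrected_z_identity:
  fixes \<alpha> \<beta> s r c m n b \<rho> q \<phi>' :: complex
  assumes r: "s * r = 1" and q: "q = \<alpha> - \<i> * \<beta>" and unit: "\<alpha>\<^sup>2 + \<beta>\<^sup>2 = 1"
    and phi: "\<phi>' = \<beta> * s / 2 + \<beta> * c\<^sup>2 * r + \<rho>"
  defines "p \<equiv> \<alpha> + \<i> * \<beta>"
    and "c' \<equiv> - (\<alpha> * s / 2 * c)" and "m' \<equiv> c * n"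
    and "n' \<equiv> - (c * m) + \<beta> * s / 2 * b" and "b' \<equiv> - (\<beta> * s / 2 * n)" and "r' \<equiv> - (r\<^sup>2)"
  shows "b' + \<i> * n' - 2 * \<i> * q * (c' * r * m + c * r' * m + c * r * m')
     + 4 * \<i> * q\<^sup>2 * (c' * r ^ 3 * m + 3 * c * r\<^sup>2 * r' * m + c * r ^ 3 * m')
     + 2 * \<i> * q * (3 * c\<^sup>2 * c' * r ^ 3 * m + 3 * c ^ 3 * r\<^sup>2 * r' * m + c ^ 3 * r ^ 3 * m')
     + q\<^sup>2 * ((2 * c * c' * r\<^sup>2 + 2 * c\<^sup>2 * r * r') * (b - \<i> * n) + c\<^sup>2 * r\<^sup>2 * (b' - \<i> * n'))
     - \<i> * \<phi>' * (b + \<i> * n - 2 * \<i> * q * (c * r * m) + 4 * \<i> * q\<^sup>2 * (c * r ^ 3 * m)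
         + 2 * \<i> * q * (c ^ 3 * r ^ 3 * m) + q\<^sup>2 * (c\<^sup>2 * r\<^sup>2 * (b - \<i> * n)))
   = remainder q \<alpha> \<beta> c r \<rho> m n (b + \<i> * n) (b - \<i> * n)" (is "?L = _")
proof -
  \<comment> \<open>In terms of the half parameter \<open>h\<close> both sides are polynomials without denominators.\<close>
  define h where "h = s / 2"
  then have s: "s = 2 * h" by (simp add: h_def)
  \<comment> \<open>The difference of the two sides lies in the ideal of the relations \<open>s * r = 1\<close> and \<open>p * q = 1\<close>,
    with cofactors \<open>X\<close> and \<open>Y\<close>; exhibiting them leaves a plain ring identity.\<close>
  define X where "X = \<i> * p * q * c * m - 2 * \<i> * p * q\<^sup>2 * c * r\<^sup>2 * m
    - \<i> * q * (3 * \<alpha> + \<i> * \<beta>) * c ^ 3 * r\<^sup>2 * m - p * q\<^sup>2 * c\<^sup>2 * r * (b - \<i> * n)"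
  define Y where "Y = \<i> * c * m - 2 * \<i> * q * c * r\<^sup>2 * m - q * c\<^sup>2 * r * (b - \<i> * n)"
  have "?L - remainder q \<alpha> \<beta> c r \<rho> m n (b + \<i> * n) (b - \<i> * n) = (s * r - 1) * X + (p * q - 1) * Y"
    unfolding c'_def m'_def n'_def b'_def r'_def phi remainder_def X_def Y_def p_def q s
    by (simp add: algebra_simps power2_eq_square power3_eq_cube)
  moreover have "p * q = 1"
    using unit by (simp add: p_def q algebra_simps power2_eq_square)
  ultimately show ?thesis using r by simp
qed

lemma remainder_bound:
  fixes \<alpha> \<beta> r c m n z w \<rho> q :: complex and k :: real
  assumes c: "norm c \<le> k" and k: "1 \<le> k" and r: "norm r \<le> 1" and q: "norm q = 1"
    and \<beta>: "norm \<beta> \<le> 1" and rho: "norm \<rho> \<le> norm c ^ 4 * norm r ^ 3"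
    and m: "norm m \<le> 1" and n: "norm n \<le> 1" and z: "norm z \<le> 1" and w: "norm w \<le> 1"
  shows "norm (remainder q \<alpha> \<beta> c r \<rho> m n z w)
    \<le> 50 * k ^ 6 * (norm c * (norm \<alpha> / 2 * norm r + 2 * norm r ^ 3))"
proof -
  define A C R where "A = norm \<alpha>" "C = norm c" "R = norm r"
  note ACR = this
  have nonneg: "A \<ge> 0" "C \<ge> 0" "R \<ge> 0" by (simp_all add: ACR)
  have shrink: "norm (x * y) \<le> B" if "norm x \<le> B" "norm y \<le> 1" for x y :: complex and B
  proof -
    have "norm x * norm y \<le> norm x" using that by (simp add: mult_left_le)
    then show ?thesis using that by (simp add: norm_mult)
  qed
  have "norm (\<beta> * (c\<^sup>2 * r)) \<le> C\<^sup>2 * R"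
    by (subst mult.commute, rule shrink) (use \<beta> in \<open>auto simp: norm_mult norm_power ACR\<close>)
  then have phase_rate: "norm (\<i> * \<beta> * c\<^sup>2 * r + \<i> * \<rho> + a * r) \<le> C\<^sup>2 * R + C ^ 4 * R ^ 3 + norm a * R"
    for a
    by (intro norm_triangle_le add_mono)
      (use rho in \<open>auto simp: norm_mult norm_power ACR mult.assoc\<close>)
  have cubic: "norm (4 * \<i> * q\<^sup>2 * c + 2 * \<i> * q * c ^ 3) \<le> 4 * C + 2 * C ^ 3"
    by (rule norm_triangle_le) (simp add: norm_mult norm_power ACR q)
  have T1: "norm ((\<i> * \<rho> + \<alpha> * c\<^sup>2 * r) * z) \<le> C ^ 4 * R ^ 3 + A * C\<^sup>2 * R"
    by (rule shrink, rule norm_triangle_le, rule add_mono)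
      (use rho z in \<open>auto simp: norm_mult norm_power ACR\<close>)
  have T2: "norm (q\<^sup>2 * c\<^sup>2 * r\<^sup>2 * (\<i> * \<beta> * c\<^sup>2 * r + \<i> * \<rho> + 2 * r) * w)
      \<le> C\<^sup>2 * R\<^sup>2 * (C\<^sup>2 * R + C ^ 4 * R ^ 3 + 2 * R)"
    by (rule shrink, subst norm_mult, rule mult_mono)
      (use phase_rate[of 2] nonneg w in \<open>auto simp: norm_mult norm_power q ACR\<close>)
  have T3a: "norm (2 * \<i> * q * c * r * \<i> * \<rho>) \<le> 2 * C * R * (C ^ 4 * R ^ 3)"
    unfolding norm_mult[of _ \<rho>]
    by (rule mult_mono) (use rho in \<open>auto simp: norm_mult q ACR\<close>)
  have T3b: "norm ((4 * \<i> * q\<^sup>2 * c + 2 * \<i> * q * c ^ 3) * r ^ 3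
        * (\<i> * \<beta> * c\<^sup>2 * r + \<i> * \<rho> + 3 * r))
      \<le> (4 * C + 2 * C ^ 3) * R ^ 3 * (C\<^sup>2 * R + C ^ 4 * R ^ 3 + 3 * R)"
    unfolding norm_mult[of "_ * _" "_ + _"] norm_mult[of _ "r ^ 3"]
    by (intro mult_mono cubic) (use phase_rate[of 3] nonneg in \<open>auto simp: norm_power ACR\<close>)
  have T3c: "norm (2 * \<i> * q * \<alpha> * c ^ 3 * r\<^sup>2) \<le> 2 * A * C ^ 3 * R\<^sup>2"
    by (simp add: norm_mult norm_power q ACR)
  have T3: "norm ((2 * \<i> * q * c * r * \<i> * \<rho>
        - (4 * \<i> * q\<^sup>2 * c + 2 * \<i> * q * c ^ 3) * r ^ 3 * (\<i> * \<beta> * c\<^sup>2 * r + \<i> * \<rho> + 3 * r)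
        - 2 * \<i> * q * \<alpha> * c ^ 3 * r\<^sup>2) * m)
      \<le> 2 * C * R * (C ^ 4 * R ^ 3)
      + (4 * C + 2 * C ^ 3) * R ^ 3 * (C\<^sup>2 * R + C ^ 4 * R ^ 3 + 3 * R) + 2 * A * C ^ 3 * R\<^sup>2"
    by (rule shrink[OF _ m]) (intro norm_triangle_le_diff add_mono T3a T3b T3c)
  have T4: "norm ((4 * \<i> * q\<^sup>2 * c + 2 * \<i> * q * c ^ 3) * r ^ 3 * c * n)
      \<le> (4 * C + 2 * C ^ 3) * R ^ 3 * C"
    by (rule shrink[OF _ n], unfold norm_mult[of _ c] norm_mult[of _ "r ^ 3"],
        intro mult_mono cubic) (use nonneg in \<open>auto simp: norm_power ACR\<close>)
  have "norm (remainder q \<alpha> \<beta> c r \<rho> m n z w) \<le>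
      C ^ 4 * R ^ 3 + A * C\<^sup>2 * R + C\<^sup>2 * R\<^sup>2 * (C\<^sup>2 * R + C ^ 4 * R ^ 3 + 2 * R)
      + (2 * C * R * (C ^ 4 * R ^ 3)
        + (4 * C + 2 * C ^ 3) * R ^ 3 * (C\<^sup>2 * R + C ^ 4 * R ^ 3 + 3 * R) + 2 * A * C ^ 3 * R\<^sup>2)
      + (4 * C + 2 * C ^ 3) * R ^ 3 * C"
    unfolding remainder_def
    by (intro norm_triangle_le norm_triangle_le_diff add_mono T2 T3 T4)
      (use T1 in simp)
  also have "\<dots> = C ^ Suc 3 * R ^ 3 + A * (C ^ Suc 1 * R ^ 1) + C ^ Suc 3 * R ^ 3
      + C ^ Suc 5 * R ^ 5 + 2 * (C ^ Suc 1 * R ^ 3) + 2 * (C ^ Suc 4 * R ^ 4)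
      + 4 * (C ^ Suc 2 * R ^ 4) + 4 * (C ^ Suc 4 * R ^ 6) + 12 * (C ^ Suc 0 * R ^ 4)
      + 2 * (C ^ Suc 4 * R ^ 4) + 2 * (C ^ Suc 6 * R ^ 6) + 6 * (C ^ Suc 2 * R ^ 4)
      + 2 * (A * (C ^ Suc 2 * R ^ 2)) + 4 * (C ^ Suc 1 * R ^ 3) + 2 * (C ^ Suc 3 * R ^ 3)"
    by (simp add: algebra_simps eval_nat_numeral)
  also have "\<dots> \<le> 43 * (k ^ 6 * (C * R ^ 3)) + 3 * (A * (k ^ 6 * (C * R ^ 1)))"
  proof -
    have mb: "C ^ Suc j * R ^ p \<le> k ^ 6 * (C * R ^ l)" if "j \<le> 6" "l \<le> p" for j p l
      using that c k r nonneg by (intro monomial_bound) (auto simp: ACR)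
    have "A * (C ^ Suc 1 * R ^ 1) \<le> A * (k ^ 6 * (C * R ^ 1))"
      "A * (C ^ Suc 2 * R ^ 2) \<le> A * (k ^ 6 * (C * R ^ 1))"
      by (intro mult_left_mono mb nonneg; simp)+
    then show ?thesis
      using mb[of 0 3 4] mb[of 1 3 3] mb[of 2 3 4] mb[of 3 3 3] mb[of 4 3 4]
        mb[of 4 3 6] mb[of 5 3 5] mb[of 6 3 6] by linarith
  qed
  also have "\<dots> \<le> 50 * k ^ 6 * (C * (A / 2 * R + 2 * R ^ 3))"
  proof -
    have "0 \<le> k ^ 6 * (A * C * R)" "0 \<le> k ^ 6 * (C * R ^ 3)" using nonneg k by auto
    then show ?thesis by (simp add: algebra_simps)
  qed
  finally show ?thesis by (simp add: ACR)
qed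

section \<open>Asymptotics of the normal and binormal components\<close>

lemma sqrt_linearisation:
  fixes x :: real
  assumes "x \<ge> 0"
  shows "\<bar>sqrt (1 + x) - (1 + x / 2)\<bar> \<le> x\<^sup>2 / 8"
proof -
  define y where "y = sqrt (1 + x)"
  have y2: "y\<^sup>2 = 1 + x" and y: "1 \<le> y" using assms by (auto simp: y_def)
  have "y \<le> 1 + x / 2"
    unfolding y_def using assms by (intro real_le_lsqrt) (auto simp: power2_eq_square algebra_simps)
  then have "(y - 1)\<^sup>2 \<le> (x / 2)\<^sup>2" using y by (intro power_mono) auto
  moreover have "y - (1 + x / 2) = - ((y - 1)\<^sup>2 / 2)"
    using y2 by (simp add: power2_eq_square field_simps)
  ultimately show ?thesis
    by (simp add: y_def[symmetric] power_divide)
qed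

context frenet_row
begin

text \<open>As \<open>\<alpha>\<^sup>2 + \<beta>\<^sup>2 = 1\<close>, this is the inverse of \<open>\<alpha> + \<i>\<beta>\<close>, by which the integrations by parts divide.\<close>

definition q :: complex where "q = \<alpha> - \<i> * \<beta>"

lemma norm_q: "norm q = 1"
  using beta_bounds(3)[OF \<alpha>] by (simp add: q_def cmod_def power2_eq_square)

definition z :: "real \<Rightarrow> complex" where "z s = of_real (b s) + \<i> * of_real (n s)"

definition corrected_z :: "real \<Rightarrow> complex" where
  "corrected_z s = of_real (b s) + \<i> * of_real (n s) - 2 * \<i> * q * of_real (c s * r s * m s)
     + 4 * \<i> * q\<^sup>2 * of_real (c s * r s ^ 3 * m s) + 2 * \<i> * q * of_real (c s ^ 3 * r s ^ 3 * m s)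
     + q\<^sup>2 * (of_real ((c s)\<^sup>2 * (r s)\<^sup>2 * b s) - \<i> * of_real ((c s)\<^sup>2 * (r s)\<^sup>2 * n s))"

lemma corrected_z_derivative:
  assumes s: "s > 0" and d\<phi>: "(\<phi> has_real_derivative \<beta> * s / 2 + \<beta> * (c s)\<^sup>2 * r s + \<rho>) (at s)"
  shows "((\<lambda>s. cis (- \<phi> s) * corrected_z s) has_vector_derivative
    cis (- \<phi> s) * remainder q \<alpha> \<beta> (c s) (r s) \<rho> (m s) (n s) (z s) (cnj (z s))) (at s)"
proof -
  define \<phi>' where "\<phi>' = \<beta> * s / 2 + \<beta> * (c s)\<^sup>2 * r s + \<rho>"
  have cis: "((\<lambda>s. cis (- \<phi> s)) has_vector_derivative - (\<i> * of_real \<phi>') * cis (- \<phi> s)) (at s)"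
  proof -
    have D: "((\<lambda>s. of_real (cos (\<phi> s)) - \<i> * of_real (sin (\<phi> s))) has_vector_derivative
        of_real (- (\<phi>' * sin (\<phi> s))) - \<i> * of_real (\<phi>' * cos (\<phi> s))) (at s)"
      using d\<phi> unfolding \<phi>'_def[symmetric]
      by (intro has_vector_derivative_diff has_vector_derivative_mult_right
          has_vector_derivative_of_real) (auto intro!: derivative_eq_intros)
    have cis_eq: "cis (- x) = of_real (cos x) - \<i> * of_real (sin x)" for x
      by (simp add: complex_eq_iff)
    show ?thesis
      unfolding cis_eq by (rule has_vector_derivative_eq_rhs[OF D]) (simp add: algebra_simps)
  qed
  let ?c' = "- (\<alpha> * s / 2 * c s)" and ?m' = "c s * n s"
    and ?n' = "- (c s * m s) + \<beta> * s / 2 * b s" and ?b' = "- (\<beta> * s / 2 * n s)"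
    and ?r' = "- (r s ^ 2)"
  note dd = dm dn db dc dr[OF s]
  have z': "(corrected_z has_vector_derivative
     of_real ?b' + \<i> * of_real ?n' - 2 * \<i> * q * of_real (?c' * r s * m s + c s * ?r' * m s + c s * r s * ?m')
     + 4 * \<i> * q\<^sup>2 * of_real (?c' * r s ^ 3 * m s + 3 * c s * (r s)\<^sup>2 * ?r' * m s + c s * r s ^ 3 * ?m')
     + 2 * \<i> * q * of_real (3 * (c s)\<^sup>2 * ?c' * r s ^ 3 * m s + 3 * c s ^ 3 * (r s)\<^sup>2 * ?r' * m s
         + c s ^ 3 * r s ^ 3 * ?m')
     + q\<^sup>2 * (of_real ((2 * c s * ?c' * (r s)\<^sup>2 + 2 * (c s)\<^sup>2 * r s * ?r') * b s + (c s)\<^sup>2 * (r s)\<^sup>2 * ?b')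
         - \<i> * of_real ((2 * c s * ?c' * (r s)\<^sup>2 + 2 * (c s)\<^sup>2 * r s * ?r') * n s + (c s)\<^sup>2 * (r s)\<^sup>2 * ?n')))
     (at s)"
    unfolding corrected_z_def[abs_def]
    by (intro has_vector_derivative_add has_vector_derivative_diff has_vector_derivative_mult_right
        has_vector_derivative_of_real dd)
      (auto intro!: derivative_eq_intros dd simp: power2_eq_square algebra_simps)
  have zz: "cnj (z s) = of_real (b s) - \<i> * of_real (n s)" by (simp add: z_def)
  have sr: "complex_of_real s * complex_of_real (r s) = 1"
    using r_bounds(3)[OF s] by (metis of_real_1 of_real_mult)
  have ab: "(complex_of_real \<alpha>)\<^sup>2 + (complex_of_real \<beta>)\<^sup>2 = 1"
    using beta_bounds(3)[OF \<alpha>] by (metis of_real_1 of_real_add of_real_power)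
  have "complex_of_real \<phi>' = of_real \<beta> * of_real s / 2 + of_real \<beta> * (of_real (c s))\<^sup>2 * of_real (r s) + of_real \<rho>"
    by (simp add: \<phi>'_def)
  note id = corrected_z_identity[OF sr q_def ab this,
      where m = "of_real (m s)" and n = "of_real (n s)" and b = "of_real (b s)"]
  have assemble: ?thesis
    if X: "(corrected_z has_vector_derivative X) (at s)"
      and eq: "X - \<i> * of_real \<phi>' * corrected_z s
        = remainder q \<alpha> \<beta> (c s) (r s) \<rho> (m s) (n s) (z s) (cnj (z s))" for X
    using has_vector_derivative_mult[OF cis X] unfolding eq[symmetric]
    by (simp add: algebra_simps)
  show ?thesis
    by (rule assemble[OF z'], unfold zz, unfold z_def corrected_z_def, rule trans[OF _ id])
      (simp add: algebra_simps)
qed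

lemma norm_z_le: "norm (z s) \<le> 1"
proof -
  have "(norm (z s))\<^sup>2 = (b s)\<^sup>2 + (n s)\<^sup>2" by (simp add: z_def cmod_power2)
  then have "(norm (z s))\<^sup>2 \<le> 1" using unit[of s] zero_le_power2[of "m s"] by linarith
  then show ?thesis by (simp add: abs_square_le_1)
qed

text \<open>The shift \<open>\<beta> * c\<^sup>2 / s\<close>, which the feedback of the first corrector adds to the torsion, is the linear term of the
  square root at \<open>x = 4 * c\<^sup>2 / s\<^sup>2\<close>; the quadratic one is of size \<open>s * x\<^sup>2\<close>, that is \<open>c\<^sup>4 / s\<^sup>3\<close>.\<close>

lemma phase_rate_expansion:
  assumes "s > 0"
  shows "\<bar>\<beta> * (s / 2) * sqrt (1 + 4 * (c s)\<^sup>2 * (r s)\<^sup>2) - (\<beta> * s / 2 + \<beta> * (c s)\<^sup>2 * r s)\<bar>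
    \<le> c s ^ 4 * r s ^ 3"
proof -
  define x where "x = 4 * (c s)\<^sup>2 * (r s)\<^sup>2"
  have x: "x \<ge> 0" by (simp add: x_def)
  have sr: "s * r s = 1" using r_bounds(3)[OF assms] .
  have "\<beta> * (s / 2) * sqrt (1 + x) - (\<beta> * s / 2 + \<beta> * (c s)\<^sup>2 * r s)
      = \<beta> * (s / 2) * (sqrt (1 + x) - (1 + x / 2)) + \<beta> * (c s)\<^sup>2 * r s * (s * r s - 1)"
    by (simp add: x_def algebra_simps power2_eq_square)
  also have "\<dots> = \<beta> * (s / 2 * (sqrt (1 + x) - (1 + x / 2)))"
    by (simp add: sr)
  finally have "\<bar>\<beta> * (s / 2) * sqrt (1 + x) - (\<beta> * s / 2 + \<beta> * (c s)\<^sup>2 * r s)\<bar>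
      = \<beta> * (s / 2 * \<bar>sqrt (1 + x) - (1 + x / 2)\<bar>)"
    using assms beta_bounds(1)[OF \<alpha>] by (simp only: abs_mult)
  also have "\<dots> \<le> 1 * (s / 2 * (x\<^sup>2 / 8))"
    using assms beta_bounds[OF \<alpha>] sqrt_linearisation[OF x]
    by (intro mult_mono mult_left_mono) auto
  also have "\<dots> = (s * r s) * (c s ^ 4 * r s ^ 3)"
    by (simp add: x_def power_mult_distrib eval_nat_numeral)
  finally show ?thesis by (simp add: sr x_def)
qed

lemma corrected_z_near:
  assumes s: "s \<ge> 1"
  shows "norm (corrected_z s - (z s - 2 * \<i> * q * of_real (c s * r s * m s))) \<le> 7 * k ^ 6 * (c s * r s ^ 2)"
    and "norm (corrected_z s - z s) \<le> 9 * k ^ 6 * (c s * r s)"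
proof -
  note pos = c_r_bounds[OF s] and mb = c_r_monomial_bound[OF s, where N = 6]
  have scale: "norm (of_real x * y) \<le> x * B" if "0 \<le> x" "norm y \<le> B" for x B and y :: complex
    using that by (simp add: norm_mult mult_left_mono)
  have T: "norm (of_real (c s * r s) * (2 * \<i> * q * of_real (m s))) \<le> c s * r s * 2"
    "norm (of_real (c s * r s ^ 3) * (4 * \<i> * q\<^sup>2 * of_real (m s))) \<le> c s * r s ^ 3 * 4"
    "norm (of_real (c s ^ 3 * r s ^ 3) * (2 * \<i> * q * of_real (m s))) \<le> c s ^ 3 * r s ^ 3 * 2"
    "norm (of_real (c s ^ 2 * r s ^ 2) * (q\<^sup>2 * cnj (z s))) \<le> c s ^ 2 * r s ^ 2 * 1"
    by (rule scale; use pos entry_bounds(1) norm_z_le in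
        \<open>simp add: norm_mult norm_power norm_q del: of_real_mult of_real_power\<close>)+
  have eq: "corrected_z s - (z s - 2 * \<i> * q * of_real (c s * r s * m s))
     = of_real (c s * r s ^ 3) * (4 * \<i> * q\<^sup>2 * of_real (m s))
     + of_real (c s ^ 3 * r s ^ 3) * (2 * \<i> * q * of_real (m s))
     + of_real (c s ^ 2 * r s ^ 2) * (q\<^sup>2 * cnj (z s))"
    by (simp add: corrected_z_def z_def algebra_simps)
  have "norm (corrected_z s - (z s - 2 * \<i> * q * of_real (c s * r s * m s)))
      \<le> c s * r s ^ 3 * 4 + c s ^ 3 * r s ^ 3 * 2 + c s ^ 2 * r s ^ 2 * 1"
    unfolding eq by (intro norm_triangle_le add_mono T)
  also have "\<dots> \<le> 7 * k ^ 6 * (c s * r s ^ 2)"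
    using mb[of 0 2 3] mb[of 2 2 3] mb[of 1 2 2] by (simp add: eval_nat_numeral)
  finally show 1: "norm (corrected_z s - (z s - 2 * \<i> * q * of_real (c s * r s * m s)))
      \<le> 7 * k ^ 6 * (c s * r s ^ 2)" .
  have "corrected_z s - z s = (corrected_z s - (z s - 2 * \<i> * q * of_real (c s * r s * m s)))
      - of_real (c s * r s) * (2 * \<i> * q * of_real (m s))"
    by simp
  then have "norm (corrected_z s - z s) \<le> 7 * k ^ 6 * (c s * r s ^ 2) + c s * r s * 2"
    using T(1) 1 by (metis add_mono norm_triangle_le_diff)
  also have "\<dots> \<le> 9 * k ^ 6 * (c s * r s)"
  proof -
    have "c s * r s ^ 2 \<le> c s * r s"
      using pos power_decreasing[of 1 2 "r s"] by (intro mult_left_mono) auto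
    then have "7 * k ^ 6 * (c s * r s ^ 2) \<le> 7 * k ^ 6 * (c s * r s)"
      by (rule mult_left_mono) (use pos in simp)
    then show ?thesis using mb[of 0 1 1] by simp
  qed
  finally show "norm (corrected_z s - z s) \<le> 9 * k ^ 6 * (c s * r s)" .
qed

lemma normal_limit:
  assumes t: "t \<ge> 1"
    and d\<Psi>: "\<And>s. s \<ge> t \<Longrightarrow>
      (\<Psi> has_real_derivative \<beta> * (s / 2) * sqrt (1 + 4 * (c s)\<^sup>2 * (r s)\<^sup>2)) (at s)"
    and A: "(m \<longlongrightarrow> A) at_top"
  obtains W where "norm W = sqrt (1 - A\<^sup>2)"
    "\<And>s. s \<ge> t \<Longrightarrow> norm (corrected_z s - cis (\<Psi> s) * W) \<le> 50 * k ^ 6 * (c s * r s ^ 2)"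
proof -
  define V where "V s = cis (- \<Psi> s) * corrected_z s" for s
  define \<rho> where
    "\<rho> s = \<beta> * (s / 2) * sqrt (1 + 4 * (c s)\<^sup>2 * (r s)\<^sup>2) - (\<beta> * s / 2 + \<beta> * (c s)\<^sup>2 * r s)" for s
  have "\<exists>W. (V \<longlongrightarrow> W) at_top \<and> (\<forall>s\<ge>t. norm (V s - W) \<le> 50 * k ^ 6 * (c s * r s ^ 2))"
  proof (rule limit_with_rate)
    fix s :: real assume "s \<ge> t"
    then have s: "s \<ge> 1" "s > 0" using t by auto
    note pos = c_r_bounds[OF s(1)]
    show "(V has_vector_derivative
        cis (- \<Psi> s) * remainder q \<alpha> \<beta> (c s) (r s) (\<rho> s) (m s) (n s) (z s) (cnj (z s))) (at s)"
      unfolding V_def[abs_def]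
      by (rule corrected_z_derivative[OF s(2)]) (use d\<Psi>[OF \<open>s \<ge> t\<close>] in \<open>simp add: \<rho>_def\<close>)
    show "((\<lambda>s. c s * r s ^ 2) has_real_derivative - (c s * (\<alpha> / 2 * r s + 2 * r s ^ 3))) (at s)"
      using dcr[OF s(2), of 1] by (simp add: eval_nat_numeral)
    have rho: "\<bar>\<rho> s\<bar> \<le> c s ^ 4 * r s ^ 3"
      unfolding \<rho>_def by (rule phase_rate_expansion[OF s(2)])
    have "norm (remainder q \<alpha> \<beta> (c s) (r s) (\<rho> s) (m s) (n s) (z s) (cnj (z s)))
        \<le> 50 * k ^ 6 * (norm (complex_of_real (c s)) * (norm (complex_of_real \<alpha>) / 2
            * norm (complex_of_real (r s)) + 2 * norm (complex_of_real (r s)) ^ 3))"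
      by (rule remainder_bound)
        (use pos beta_bounds[OF \<alpha>] norm_q entry_bounds norm_z_le rho in simp_all)
    then show "norm (cis (- \<Psi> s) * remainder q \<alpha> \<beta> (c s) (r s) (\<rho> s) (m s) (n s) (z s) (cnj (z s)))
        \<le> 50 * k ^ 6 * (c s * (\<alpha> / 2 * r s + 2 * r s ^ 3))"
      using pos \<alpha> by (simp add: norm_mult)
    show "0 \<le> c s * r s ^ 2" using pos by simp
  next
    show "((\<lambda>s. c s * r s ^ 2) \<longlongrightarrow> 0) at_top"
      using cr_tendsto_0[of 1] by (simp add: eval_nat_numeral)
  qed (use c0 in auto)
  then obtain W where W: "(V \<longlongrightarrow> W) at_top"
    "\<And>s. s \<ge> t \<Longrightarrow> norm (V s - W) \<le> 50 * k ^ 6 * (c s * r s ^ 2)"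
    by auto
  have rate: "norm (corrected_z s - cis (\<Psi> s) * W) \<le> 50 * k ^ 6 * (c s * r s ^ 2)" if "s \<ge> t" for s
  proof -
    have "corrected_z s - cis (\<Psi> s) * W = cis (\<Psi> s) * (V s - W)"
      by (simp add: V_def algebra_simps cis_mult flip: mult.assoc)
    then show ?thesis using W(2)[OF that] by (simp add: norm_mult)
  qed
  have "((\<lambda>s. norm (corrected_z s)) \<longlongrightarrow> norm W) at_top"
    using tendsto_norm[OF W(1)] by (simp add: V_def norm_mult)
  moreover have "((\<lambda>s. norm (corrected_z s)) \<longlongrightarrow> sqrt (1 - A\<^sup>2)) at_top"
  proof (rule Lim_transform)
    have "norm (z s) = sqrt (1 - (m s)\<^sup>2)" for s
      using unit[of s] by (simp add: z_def cmod_def)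
    then show "((\<lambda>s. norm (z s)) \<longlongrightarrow> sqrt (1 - A\<^sup>2)) at_top"
      using A by (auto intro!: tendsto_intros)
    have lim: "((\<lambda>s. 9 * k ^ 6 * (c s * r s ^ Suc 0)) \<longlongrightarrow> 0) at_top"
      by (rule tendsto_mult_right_zero[OF cr_tendsto_0])
    have "\<bar>norm (corrected_z s) - norm (z s)\<bar> \<le> 9 * k ^ 6 * (c s * r s ^ Suc 0)" if "s \<ge> 1" for s
      using corrected_z_near(2)[OF that] norm_triangle_ineq3[of "corrected_z s" "z s"] by simp
    then show "((\<lambda>s. norm (corrected_z s) - norm (z s)) \<longlongrightarrow> 0) at_top"
      by (intro Lim_null_comparison[OF _ lim])
        (auto simp: eventually_at_top_linorder intro!: exI[of _ 1])
  qed
  ultimately have "norm W = sqrt (1 - A\<^sup>2)"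
    using tendsto_unique[OF trivial_limit_at_top_linorder] by blast
  with rate that show thesis by blast
qed

text \<open>The polar form of the limit \<open>W\<close> supplies the amplitude and the initial phase. Replacing \<open>m s\<close> by its limit in the
  first corrector of \<open>z\<close> gives the expansions of \<open>n\<close> and \<open>b\<close>, and these, inserted into the corrected tangent,
  that of \<open>m\<close>.\<close>

lemma row_asymptotics:
  assumes t: "t \<ge> 1"
    and d\<Psi>: "\<And>s. s \<ge> t \<Longrightarrow>
      (\<Psi> has_real_derivative \<beta> * (s / 2) * sqrt (1 + 4 * (c s)\<^sup>2 * (r s)\<^sup>2)) (at s)"
  obtains A a where "0 \<le> a" "a < 2 * pi" "(m \<longlongrightarrow> A) at_top"
    "\<And>s. s \<ge> t \<Longrightarrow> \<bar>m s - (A - 2 * c s * r s * (sqrt (1 - A\<^sup>2) * (\<alpha> * sin (a + \<Psi> s) + \<beta> * cos (a + \<Psi> s)))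
        - 2 * (c s)\<^sup>2 * (r s)\<^sup>2 * A)\<bar> \<le> 1200 * k ^ 8 * (c s * r s ^ 3)"
    "\<And>s. s \<ge> t \<Longrightarrow> \<bar>n s - (sqrt (1 - A\<^sup>2) * sin (a + \<Psi> s) + 2 * c s * r s * \<alpha> * A)\<bar>
        \<le> 220 * k ^ 7 * (c s * r s ^ 2)"
    "\<And>s. s \<ge> t \<Longrightarrow> \<bar>b s - (sqrt (1 - A\<^sup>2) * cos (a + \<Psi> s) + 2 * c s * r s * \<beta> * A)\<bar>
        \<le> 220 * k ^ 7 * (c s * r s ^ 2)"
proof -
  obtain A where A: "(m \<longlongrightarrow> A) at_top"
    "\<And>s. s \<ge> 1 \<Longrightarrow> \<bar>corrected_m s - A\<bar> \<le> 50 * k ^ 6 * (c s * r s ^ 3)"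
    "\<And>s. s \<ge> 1 \<Longrightarrow> \<bar>m s - A\<bar> \<le> 80 * k ^ 6 * (c s * r s)"
    using tangent_limit by blast
  obtain W where W: "norm W = sqrt (1 - A\<^sup>2)"
    "\<And>s. s \<ge> t \<Longrightarrow> norm (corrected_z s - cis (\<Psi> s) * W) \<le> 50 * k ^ 6 * (c s * r s ^ 2)"
    by (rule normal_limit[OF t _ A(1)]) (use d\<Psi> in blast)+
  define B a where "B = sqrt (1 - A\<^sup>2)" and "a = Arg2pi W"
  have a: "0 \<le> a" "a < 2 * pi" using Arg2pi[of W] by (auto simp: a_def)
  have "W = of_real B * cis a"
    using Arg2pi_eq[of W] by (simp add: a_def B_def W(1) cis_conv_exp)
  then have rot: "cis (\<Psi> s) * W = of_real B * cis (a + \<Psi> s)" for s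
    by (simp add: cis_mult[symmetric])
  have complex_error: "norm (z s - (of_real B * cis (a + \<Psi> s) + 2 * \<i> * q * of_real (c s * r s * A)))
      \<le> 220 * k ^ 7 * (c s * r s ^ 2)" if "s \<ge> t" for s
  proof -
    have s: "s \<ge> 1" using that t by simp
    note pos = c_r_bounds[OF s]
    have m: "norm (2 * \<i> * q * of_real (c s * r s * (m s - A))) \<le> 2 * (c s * r s * (80 * k ^ 6 * (c s * r s)))"
      using mult_left_mono[OF A(3)[OF s] mult_nonneg_nonneg[OF pos(1,2)]] pos
      by (simp only: norm_mult norm_of_real norm_q abs_mult norm_ii norm_numeral)
    also have "\<dots> = 160 * k ^ 6 * (c s * (c s * r s ^ 2))"
      by (simp add: power2_eq_square)
    also have "\<dots> \<le> 160 * k ^ 6 * (k * (c s * r s ^ 2))"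
      using pos by (intro mult_left_mono mult_right_mono) auto
    finally have m: "norm (2 * \<i> * q * of_real (c s * r s * (m s - A))) \<le> 160 * k ^ 7 * (c s * r s ^ 2)"
      by (simp add: eval_nat_numeral algebra_simps)
    have "k ^ 6 * (c s * r s ^ 2) \<le> k ^ 7 * (c s * r s ^ 2)"
      using pos by (intro mult_right_mono power_increasing) auto
    moreover have "z s - (of_real B * cis (a + \<Psi> s) + 2 * \<i> * q * of_real (c s * r s * A))
        = (corrected_z s - cis (\<Psi> s) * W)
        - (corrected_z s - (z s - 2 * \<i> * q * of_real (c s * r s * m s)))
        + 2 * \<i> * q * of_real (c s * r s * (m s - A))"
      unfolding rot by (simp add: algebra_simps)
    then have "norm (z s - (of_real B * cis (a + \<Psi> s) + 2 * \<i> * q * of_real (c s * r s * A)))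
        \<le> 50 * k ^ 6 * (c s * r s ^ 2) + 7 * k ^ 6 * (c s * r s ^ 2) + 160 * k ^ 7 * (c s * r s ^ 2)"
      by (simp only:) (intro norm_triangle_le norm_triangle_le_diff add_mono W(2) corrected_z_near(1) that s m)
    moreover have "0 \<le> k ^ 7 * (c s * r s ^ 2)" using pos by simp
    ultimately show ?thesis by linarith
  qed
  have n_error: "\<bar>n s - (B * sin (a + \<Psi> s) + 2 * c s * r s * \<alpha> * A)\<bar> \<le> 220 * k ^ 7 * (c s * r s ^ 2)"
    and b_error: "\<bar>b s - (B * cos (a + \<Psi> s) + 2 * c s * r s * \<beta> * A)\<bar> \<le> 220 * k ^ 7 * (c s * r s ^ 2)"
    if "s \<ge> t" for s
    using order_trans[OF abs_Im_le_cmod complex_error[OF that]]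
      order_trans[OF abs_Re_le_cmod complex_error[OF that]]
    by (simp_all add: z_def q_def algebra_simps)
  have m_error: "\<bar>m s - (A - 2 * c s * r s * (B * (\<alpha> * sin (a + \<Psi> s) + \<beta> * cos (a + \<Psi> s)))
        - 2 * (c s)\<^sup>2 * (r s)\<^sup>2 * A)\<bar> \<le> 1200 * k ^ 8 * (c s * r s ^ 3)" if "s \<ge> t" for s
  proof -
    have s: "s \<ge> 1" using that t by simp
    note pos = c_r_bounds[OF s]
    define E where "E = k ^ 8 * (c s * r s ^ 3)"
    note mb = c_r_monomial_bound[OF s, where N = 8 and l = 3]
    note shrink = abs_mult_le_of_le_one[OF \<alpha>] abs_mult_le_of_le_one[OF beta_bounds(1,2)[OF \<alpha>]]
    \<comment> \<open>The term \<open>2 * (c s)\<^sup>2 * (r s)\<^sup>2 * m s\<close> of the corrected tangent and the part of \<open>P s\<close> along \<open>A\<close>, which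
      contributes \<open>- 4 * (c s)\<^sup>2 * (r s)\<^sup>2 * A\<close>, add up to the second-order term of the expansion.\<close>
    define e where "e = P s - (B * (\<alpha> * sin (a + \<Psi> s) + \<beta> * cos (a + \<Psi> s)) + 2 * c s * r s * A)"
    have "e = \<alpha> * (n s - (B * sin (a + \<Psi> s) + 2 * c s * r s * \<alpha> * A))
        + \<beta> * (b s - (B * cos (a + \<Psi> s) + 2 * c s * r s * \<beta> * A))
        + (\<alpha>\<^sup>2 + \<beta>\<^sup>2 - 1) * (2 * c s * r s * A)"
      by (simp add: e_def P_def algebra_simps power2_eq_square)
    then have e: "\<bar>e\<bar> \<le> 440 * k ^ 7 * (c s * r s ^ 2)"
      using shrink(1)[OF n_error[OF that]] shrink(2)[OF b_error[OF that]] beta_bounds(3)[OF \<alpha>]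
      by simp
    have "\<bar>c s * r s * e\<bar> \<le> c s * r s * (440 * k ^ 7 * (c s * r s ^ 2))"
      by (rule abs_mult_le_mult) (use pos e in auto)
    also have "\<dots> = 440 * k ^ 7 * (c s * (c s * r s ^ 3))" by (simp add: eval_nat_numeral)
    also have "\<dots> \<le> 440 * k ^ 7 * (k * (c s * r s ^ 3))"
      using pos by (intro mult_left_mono mult_right_mono) auto
    also have "\<dots> = 440 * E" by (simp add: E_def eval_nat_numeral)
    finally have t1: "\<bar>c s * r s * e\<bar> \<le> 440 * E" .
    have "\<bar>c s ^ 2 * r s ^ 2 * (m s - A)\<bar> \<le> c s ^ 2 * r s ^ 2 * (80 * k ^ 6 * (c s * r s))"
      by (rule abs_mult_le_mult) (use pos A(3)[OF s] in auto)
    also have "\<dots> = 80 * k ^ 6 * (c s ^ 2 * (c s * r s ^ 3))" by (simp add: eval_nat_numeral)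
    also have "\<dots> \<le> 80 * k ^ 6 * (k ^ 2 * (c s * r s ^ 3))"
      using pos by (intro mult_left_mono mult_right_mono power_mono) auto
    also have "\<dots> = 80 * E" by (simp add: E_def eval_nat_numeral)
    finally have t2: "\<bar>c s ^ 2 * r s ^ 2 * (m s - A)\<bar> \<le> 80 * E" .
    have "\<bar>c s * r s ^ 3 * (\<alpha> * P s + \<beta> * Q s)\<bar> \<le> c s * r s ^ 3 * 4" "\<bar>c s ^ 3 * r s ^ 3 * P s\<bar> \<le> c s ^ 3 * r s ^ 3 * 2"
      by (rule abs_mult_le_mult; use pos P_Q_bounds in simp)+
    then have t34: "\<bar>c s * r s ^ 3 * (\<alpha> * P s + \<beta> * Q s)\<bar> \<le> 4 * E" "\<bar>c s ^ 3 * r s ^ 3 * P s\<bar> \<le> 2 * E"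
      using mb[of 0 3] mb[of 2 3] by (simp_all add: E_def eval_nat_numeral)
    have "50 * k ^ 6 * (c s * r s ^ 3) \<le> 50 * k ^ 8 * (c s * r s ^ 3)"
      using pos by (intro mult_right_mono mult_left_mono power_increasing) auto
    then have t5: "\<bar>corrected_m s - A\<bar> \<le> 50 * E"
      using A(2)[OF s] by (simp add: E_def)
    have "0 \<le> E" using pos by (simp add: E_def)
    have "m s - (A - 2 * c s * r s * (B * (\<alpha> * sin (a + \<Psi> s) + \<beta> * cos (a + \<Psi> s)))
        - 2 * (c s)\<^sup>2 * (r s)\<^sup>2 * A)
      = (corrected_m s - A) - 2 * (c s * r s * e) + 2 * (c s ^ 2 * r s ^ 2 * (m s - A))
        + 4 * (c s * r s ^ 3 * (\<alpha> * P s + \<beta> * Q s)) + 4 * (c s ^ 3 * r s ^ 3 * P s)"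
      by (simp add: corrected_m_def e_def algebra_simps power2_eq_square)
    then have "\<bar>m s - (A - 2 * c s * r s * (B * (\<alpha> * sin (a + \<Psi> s) + \<beta> * cos (a + \<Psi> s)))
        - 2 * (c s)\<^sup>2 * (r s)\<^sup>2 * A)\<bar> \<le> 1200 * E"
      using t1 t2 t34 t5 \<open>0 \<le> E\<close> by linarith
    then show ?thesis by (simp add: E_def)
  qed
  show thesis
    using that[OF a A(1)] m_error n_error b_error unfolding B_def by blast
qed

end

section \<open>The phase integral\<close>

lemma s0_ge: "s0 c0 \<ge> 4"
  by (simp add: s0_def)

text \<open>The phase without its constant, with both integrals starting at \<open>1\<close>: unlike the integral from
  \<open>(s0 c0)\<^sup>2 / 4\<close>, this is differentiable from both sides at \<open>s = s0 c0\<close>.\<close>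

definition phase_shift :: "real \<Rightarrow> real \<Rightarrow> real \<Rightarrow> real" where
  "phase_shift c0 \<alpha> s = beta \<alpha> *
     (integral {1..s\<^sup>2 / 4} (\<lambda>\<sigma>. sqrt (1 + c0\<^sup>2 * (exp (- 2 * \<alpha> * \<sigma>) / \<sigma>)))
      - integral {1..(s0 c0)\<^sup>2 / 4} (\<lambda>\<sigma>. sqrt (1 + c0\<^sup>2 * (exp (- 2 * \<alpha> * \<sigma>) / \<sigma>))))"

lemma phase_integrand_continuous:
  "continuous_on {1..u} (\<lambda>\<sigma>. sqrt (1 + c0\<^sup>2 * (exp (- 2 * \<alpha> * \<sigma>) / \<sigma>)))"
  by (intro continuous_intros) auto

lemma phase_eq_phase_shift:
  assumes "s \<ge> s0 c0"
  shows "phase c0 \<alpha> a s $ j = a $ j + phase_shift c0 \<alpha> s"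
proof -
  define f where "f = (\<lambda>\<sigma>. sqrt (1 + c0\<^sup>2 * (exp (- 2 * \<alpha> * \<sigma>) / \<sigma>)))"
  have "(s0 c0)\<^sup>2 \<ge> 4\<^sup>2" "s\<^sup>2 \<ge> (s0 c0)\<^sup>2"
    using assms s0_ge[of c0] by (intro power_mono; simp)+
  then have "1 \<le> (s0 c0)\<^sup>2 / 4" "(s0 c0)\<^sup>2 / 4 \<le> s\<^sup>2 / 4" by auto
  note combine = Henstock_Kurzweil_Integration.integral_combine[OF this
      integrable_continuous_real[OF phase_integrand_continuous[of _ c0 \<alpha>]], folded f_def]
  show ?thesis unfolding phase_def phase_shift_def f_def[symmetric] by (simp flip: combine)
qed

lemma phase_shift_derivative:
  assumes "s \<ge> s0 c0"
  shows "(phase_shift c0 \<alpha> has_real_derivative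
    beta \<alpha> * (s / 2) * sqrt (1 + 4 * (c0 * exp (- \<alpha> * s\<^sup>2 / 4))\<^sup>2 * (1 / s)\<^sup>2)) (at s)"
proof -
  define f where "f = (\<lambda>\<sigma>. sqrt (1 + c0\<^sup>2 * (exp (- 2 * \<alpha> * \<sigma>) / \<sigma>)))"
  have s: "s \<ge> 4" using assms s0_ge[of c0] by simp
  then have "s\<^sup>2 \<ge> 4\<^sup>2" by (intro power_mono) auto
  then have u: "s\<^sup>2 / 4 \<in> {1<..<s\<^sup>2 / 4 + 1}" by auto
  have "((\<lambda>u. integral {1..u} f) has_real_derivative f (s\<^sup>2 / 4)) (at (s\<^sup>2 / 4) within {1..s\<^sup>2 / 4 + 1})"
    unfolding f_def has_real_derivative_iff_has_vector_derivative
    by (rule integral_has_vector_derivative[OF phase_integrand_continuous]) (use u in auto)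
  then have "((\<lambda>u. integral {1..u} f) has_real_derivative f (s\<^sup>2 / 4)) (at (s\<^sup>2 / 4))"
    using u by (simp add: at_within_Icc_at)
  then have "((\<lambda>s. integral {1..s\<^sup>2 / 4} f) has_real_derivative f (s\<^sup>2 / 4) * (s / 2)) (at s)"
    by (rule DERIV_chain2) (auto intro!: derivative_eq_intros)
  then have deriv: "(phase_shift c0 \<alpha> has_real_derivative beta \<alpha> * (f (s\<^sup>2 / 4) * (s / 2))) (at s)"
    unfolding phase_shift_def[abs_def] f_def[symmetric]
    by (auto intro!: derivative_eq_intros)
  have integrand: "f (s\<^sup>2 / 4) = sqrt (1 + 4 * (c0 * exp (- \<alpha> * s\<^sup>2 / 4))\<^sup>2 * (1 / s)\<^sup>2)"
  proof -
    have "(exp (- \<alpha> * s\<^sup>2 / 4))\<^sup>2 = exp (- 2 * \<alpha> * (s\<^sup>2 / 4))"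
      by (simp add: power2_eq_square flip: exp_add)
    then show ?thesis by (simp add: f_def power_mult_distrib power_divide)
  qed
  show ?thesis by (rule DERIV_cong[OF deriv]) (simp add: integrand)
qed

section \<open>The vector-valued statements\<close>

lemma profile_rows:
  assumes "profile_solution c0 \<alpha> m n b"
  shows "row_ode (\<lambda>s. c0 * exp (- \<alpha> * s\<^sup>2 / 4)) (\<lambda>s. beta \<alpha> * s / 2)
      (\<lambda>s. m s $ j) (\<lambda>s. n s $ j) (\<lambda>s. b s $ j)"
    and "m 0 = vector [1, 0, 0]" "n 0 = vector [0, 1, 0]" "b 0 = vector [0, 0, 1]"
  using assms by (simp_all add: profile_solution_def row_ode_component)

lemma profile_symmetries:
  assumes "profile_solution c0 \<alpha> m n b"
  shows "even_fun (\<lambda>s. m s $ 1) \<and> (\<forall>j\<in>{2, 3}. odd_fun (\<lambda>s. m s $ j)) \<and>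
        odd_fun (\<lambda>s. n s $ 1) \<and> odd_fun (\<lambda>s. b s $ 1) \<and>
        (\<forall>j\<in>{2, 3}. even_fun (\<lambda>s. n s $ j) \<and> even_fun (\<lambda>s. b s $ j))"
proof -
  note rows = profile_rows[OF assms]
  have refl1: "m s $ 1 = 1 * m (- s) $ 1" "n s $ 1 = - (1 * n (- s) $ 1)"
    "b s $ 1 = - (1 * b (- s) $ 1)" for s
    by (rule row_ode_reflection[OF rows(1)]; simp add: rows(2-))+
  have refl23: "m s $ j = - 1 * m (- s) $ j" "n s $ j = - (- 1 * n (- s) $ j)"
    "b s $ j = - (- 1 * b (- s) $ j)" if "j \<in> {2, 3}" for s j
    by (rule row_ode_reflection[OF rows(1)]; use that in \<open>auto simp: rows(2-)\<close>)+
  have "m (- s) $ 1 = m s $ 1" "n (- s) $ 1 = - n s $ 1" "b (- s) $ 1 = - b s $ 1" for s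
    using refl1[of s] by linarith+
  moreover have "m (- s) $ j = - m s $ j" "n (- s) $ j = n s $ j" "b (- s) $ j = b s $ j"
    if "j \<in> {2, 3}" for s j
    using refl23[OF that, of s] by linarith+
  ultimately show ?thesis
    by (simp add: even_fun_def odd_fun_def)
qed

text \<open>The Gram matrix of the rows is constant. A square matrix with orthonormal rows has orthonormal columns, one of
  which is \<open>m\<close>.\<close>

lemma profile_orthonormal:
  assumes "profile_solution c0 \<alpha> m n b"
  shows "m s $ i * m s $ j + n s $ i * n s $ j + b s $ i * b s $ j = (if i = j then 1 else 0)"
    and "norm (m s) = 1"
proof -
  note rows = profile_rows[OF assms]
  have "m 0 $ i * m 0 $ j + n 0 $ i * n 0 $ j + b 0 $ i * b 0 $ j = (if i = j then 1 else 0)" for i j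
    unfolding rows(2-) using exhaust_3[of i] exhaust_3[of j] by (elim disjE) simp_all
  then show gram: "m s $ i * m s $ j + n s $ i * n s $ j + b s $ i * b s $ j
      = (if i = j then 1 else 0)" for i j
    using row_ode_inner_product[OF rows(1)[of i] rows(1)[of j], of s] by simp
  define M :: "real^3^3" where "M = (\<chi> i. vector [m s $ i, n s $ i, b s $ i])"
  have "M ** transpose M = mat 1"
    by (simp add: vec_eq_iff matrix_matrix_mult_def transpose_def mat_def sum_3 M_def gram)
  then have "transpose M ** M = mat 1" by (simp add: matrix_left_right_inverse)
  then have "(transpose M ** M) $ 1 $ 1 = 1" by (simp add: mat_def)
  then have "m s \<bullet> m s = 1"
    by (simp add: matrix_matrix_mult_def transpose_def sum_3 M_def inner_vec_def)
  then show "norm (m s) = 1" by (simp add: norm_eq_1)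
qed

lemma profile_frenet_row:
  assumes "profile_solution c0 \<alpha> m n b" "c0 > 0" "0 \<le> \<alpha>" "\<alpha> \<le> 1"
  shows "frenet_row c0 \<alpha> (\<lambda>s. m s $ j) (\<lambda>s. n s $ j) (\<lambda>s. b s $ j)"
proof -
  have "(m s $ j)\<^sup>2 + (n s $ j)\<^sup>2 + (b s $ j)\<^sup>2 = 1" for s
    using profile_orthonormal(1)[OF assms(1), of s j j] by (simp add: power2_eq_square)
  with profile_rows(1)[OF assms(1), of j] assms(2-) show ?thesis
    by unfold_locales auto
qed

lemma bigO_from_componentwise:
  assumes "\<And>s j. s \<ge> t \<Longrightarrow> \<bar>f s $ j - h s $ j\<bar> \<le> K * \<bar>g s\<bar>" "3 * K \<le> C"
  shows "bigO_from C t g f h"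
  unfolding bigO_from_def
proof (intro allI impI)
  fix s assume s: "t \<le> s"
  have "norm (f s - h s) \<le> (\<Sum>j\<in>UNIV. \<bar>(f s - h s) $ j\<bar>)" by (rule norm_le_l1_cart)
  also have "\<dots> \<le> (\<Sum>j\<in>(UNIV :: 3 set). K * \<bar>g s\<bar>)"
    using assms(1)[OF s] by (intro sum_mono) auto
  also have "\<dots> = 3 * K * \<bar>g s\<bar>" by simp
  also have "\<dots> \<le> C * \<bar>g s\<bar>" using assms(2) by (intro mult_right_mono) auto
  finally show "norm (f s - h s) \<le> C * \<bar>g s\<bar>" .
qed

lemma profile_asymptotics:
  assumes sol: "profile_solution c0 \<alpha> m n b" and c0: "c0 > 0" and \<alpha>: "0 \<le> \<alpha>" "\<alpha> \<le> 1"
  defines "C \<equiv> 3600 * (1 + c0) ^ 9"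
  shows "\<exists>A\<in>sphere 0 1. \<exists>B a. (\<forall>j. a $ j \<in> {0..<2 * pi}) \<and> B = Bplus A \<and>
           bigO_from C (s0 c0) (\<lambda>s. exp (- \<alpha> * s\<^sup>2 / 4) / s ^ 3) m
             (\<lambda>s. A
                - (2 * c0 / s) *\<^sub>R exp (- \<alpha> * s\<^sup>2 / 4) *\<^sub>R
                    (B * (\<alpha> *\<^sub>R vsin (phase c0 \<alpha> a s) + beta \<alpha> *\<^sub>R vcos (phase c0 \<alpha> a s)))
                - (2 * c0\<^sup>2 / s\<^sup>2) *\<^sub>R exp (- \<alpha> * s\<^sup>2 / 2) *\<^sub>R A) \<and>
           bigO_from C (s0 c0) (\<lambda>s. exp (- \<alpha> * s\<^sup>2 / 4) / s\<^sup>2) n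
             (\<lambda>s. B * vsin (phase c0 \<alpha> a s)
                + (2 * c0 / s) *\<^sub>R (\<alpha> * exp (- \<alpha> * s\<^sup>2 / 4)) *\<^sub>R A) \<and>
           bigO_from C (s0 c0) (\<lambda>s. exp (- \<alpha> * s\<^sup>2 / 4) / s\<^sup>2) b
             (\<lambda>s. B * vcos (phase c0 \<alpha> a s)
                + (2 * c0 / s) *\<^sub>R (beta \<alpha> * exp (- \<alpha> * s\<^sup>2 / 4)) *\<^sub>R A)"
proof -
  define e where "e s = exp (- \<alpha> * s\<^sup>2 / 4)" for s
  define \<Psi> where "\<Psi> = phase_shift c0 \<alpha>"
  define k where "k = 1 + c0"
  have k: "k \<ge> 1" "c0 \<le> k" using c0 by (auto simp: k_def)
  have "\<exists>A a. 0 \<le> a \<and> a < 2 * pi \<and> ((\<lambda>s. m s $ j) \<longlongrightarrow> A) at_top \<and>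
     (\<forall>s\<ge>s0 c0. \<bar>m s $ j - (A - 2 * (c0 * e s) * (1 / s)
          * (sqrt (1 - A\<^sup>2) * (\<alpha> * sin (a + \<Psi> s) + beta \<alpha> * cos (a + \<Psi> s)))
        - 2 * (c0 * e s)\<^sup>2 * (1 / s)\<^sup>2 * A)\<bar> \<le> 1200 * k ^ 8 * (c0 * e s * (1 / s) ^ 3)) \<and>
     (\<forall>s\<ge>s0 c0. \<bar>n s $ j - (sqrt (1 - A\<^sup>2) * sin (a + \<Psi> s) + 2 * (c0 * e s) * (1 / s) * \<alpha> * A)\<bar>
        \<le> 220 * k ^ 7 * (c0 * e s * (1 / s)\<^sup>2)) \<and>
     (\<forall>s\<ge>s0 c0. \<bar>b s $ j - (sqrt (1 - A\<^sup>2) * cos (a + \<Psi> s) + 2 * (c0 * e s) * (1 / s) * beta \<alpha> * A)\<bar>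
        \<le> 220 * k ^ 7 * (c0 * e s * (1 / s)\<^sup>2))" for j
  proof -
    interpret frenet_row c0 \<alpha> "\<lambda>s. m s $ j" "\<lambda>s. n s $ j" "\<lambda>s. b s $ j"
      by (rule profile_frenet_row[OF sol c0 \<alpha>])
    have "\<And>s. s \<ge> s0 c0 \<Longrightarrow>
      (\<Psi> has_real_derivative beta \<alpha> * (s / 2) * sqrt (1 + 4 * (c s)\<^sup>2 * (r s)\<^sup>2)) (at s)"
      using phase_shift_derivative unfolding \<Psi>_def c_def r_def by blast
    note d\<Psi> = this[unfolded c_def r_def, folded e_def]
    show ?thesis
    proof (rule row_asymptotics[of "s0 c0" \<Psi>, unfolded c_def r_def, folded e_def k_def])
      show "1 \<le> s0 c0" using s0_ge[of c0] by simp
    qed (use d\<Psi> in blast)+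
  qed
  then obtain A' a' where row: "\<And>j. 0 \<le> a' j" "\<And>j. a' j < 2 * pi"
      "\<And>j. ((\<lambda>s. m s $ j) \<longlongrightarrow> A' j) at_top"
    and m: "\<And>j s. s \<ge> s0 c0 \<Longrightarrow> \<bar>m s $ j - (A' j - 2 * (c0 * e s) * (1 / s)
          * (sqrt (1 - (A' j)\<^sup>2) * (\<alpha> * sin (a' j + \<Psi> s) + beta \<alpha> * cos (a' j + \<Psi> s)))
        - 2 * (c0 * e s)\<^sup>2 * (1 / s)\<^sup>2 * A' j)\<bar> \<le> 1200 * k ^ 8 * (c0 * e s * (1 / s) ^ 3)"
    and n: "\<And>j s. s \<ge> s0 c0 \<Longrightarrow> \<bar>n s $ j - (sqrt (1 - (A' j)\<^sup>2) * sin (a' j + \<Psi> s)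
        + 2 * (c0 * e s) * (1 / s) * \<alpha> * A' j)\<bar> \<le> 220 * k ^ 7 * (c0 * e s * (1 / s)\<^sup>2)"
    and b: "\<And>j s. s \<ge> s0 c0 \<Longrightarrow> \<bar>b s $ j - (sqrt (1 - (A' j)\<^sup>2) * cos (a' j + \<Psi> s)
        + 2 * (c0 * e s) * (1 / s) * beta \<alpha> * A' j)\<bar> \<le> 220 * k ^ 7 * (c0 * e s * (1 / s)\<^sup>2)"
    by metis
  define A a where "A = (\<chi> j. A' j)" and "a = (\<chi> j. a' j)"
  have "(m \<longlongrightarrow> A) at_top" by (rule vec_tendstoI) (simp add: A_def row)
  then have "((\<lambda>s. norm (m s)) \<longlongrightarrow> norm A) at_top" by (rule tendsto_norm)
  then have "norm A = 1"
    by (simp add: profile_orthonormal(2)[OF sol] tendsto_const_iff)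
  have phase: "phase c0 \<alpha> a s $ j = a' j + \<Psi> s" if "s \<ge> s0 c0" for s j
    using phase_eq_phase_shift[OF that] by (simp add: a_def \<Psi>_def)
  have e2: "exp (- \<alpha> * s\<^sup>2 / 2) = (e s)\<^sup>2" for s
    by (simp add: e_def power2_eq_square flip: exp_add)
  \<comment> \<open>The curvature is \<open>c0 * e s\<close>, while the error is measured against \<open>e s\<close>: this costs one more factor \<open>k\<close>.\<close>
  have gauge: "K * k ^ i * (c0 * e s * (1 / s) ^ p) \<le> 1200 * k ^ 9 * \<bar>e s / s ^ p\<bar>"
    if "s \<ge> s0 c0" "0 \<le> K" "K \<le> 1200" "i \<le> 8" for s K i p
  proof -
    have s: "s > 0" using that(1) s0_ge[of c0] by simp
    have "K * k ^ i * c0 \<le> 1200 * k ^ 8 * k"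
      using that k c0 by (intro mult_mono power_increasing) auto
    then have "K * k ^ i * c0 * (e s / s ^ p) \<le> 1200 * k ^ 8 * k * (e s / s ^ p)"
      using s by (intro mult_right_mono) (auto simp: e_def)
    then show ?thesis
      using s by (simp add: e_def power_divide eval_nat_numeral mult.assoc)
  qed
  have C: "3 * (1200 * k ^ 9) \<le> C" by (simp add: C_def k_def)
  have "bigO_from C (s0 c0) (\<lambda>s. exp (- \<alpha> * s\<^sup>2 / 4) / s ^ 3) m
             (\<lambda>s. A
                - (2 * c0 / s) *\<^sub>R exp (- \<alpha> * s\<^sup>2 / 4) *\<^sub>R
                    (Bplus A * (\<alpha> *\<^sub>R vsin (phase c0 \<alpha> a s) + beta \<alpha> *\<^sub>R vcos (phase c0 \<alpha> a s)))
                - (2 * c0\<^sup>2 / s\<^sup>2) *\<^sub>R exp (- \<alpha> * s\<^sup>2 / 2) *\<^sub>R A)"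
    unfolding e_def[symmetric] e2
  proof (rule bigO_from_componentwise[OF _ C])
    fix s j assume s: "s \<ge> s0 c0"
    have "\<bar>m s $ j - (A' j - 2 * (c0 * e s) * (1 / s)
          * (sqrt (1 - (A' j)\<^sup>2) * (\<alpha> * sin (a' j + \<Psi> s) + beta \<alpha> * cos (a' j + \<Psi> s)))
        - 2 * (c0 * e s)\<^sup>2 * (1 / s)\<^sup>2 * A' j)\<bar> \<le> 1200 * k ^ 9 * \<bar>e s / s ^ 3\<bar>"
      using m[OF s, of j] gauge[OF s, of 1200 8 3] by simp
    then show "\<bar>m s $ j - (A - (2 * c0 / s) *\<^sub>R e s *\<^sub>R
                    (Bplus A * (\<alpha> *\<^sub>R vsin (phase c0 \<alpha> a s) + beta \<alpha> *\<^sub>R vcos (phase c0 \<alpha> a s)))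
                - (2 * c0\<^sup>2 / s\<^sup>2) *\<^sub>R (e s)\<^sup>2 *\<^sub>R A) $ j\<bar> \<le> 1200 * k ^ 9 * \<bar>e s / s ^ 3\<bar>"
      by (simp add: Bplus_def vsin_def vcos_def phase[OF s] A_def power_mult_distrib power_divide
          mult.assoc)
  qed
  moreover have "bigO_from C (s0 c0) (\<lambda>s. exp (- \<alpha> * s\<^sup>2 / 4) / s\<^sup>2) n
             (\<lambda>s. Bplus A * vsin (phase c0 \<alpha> a s)
                + (2 * c0 / s) *\<^sub>R (\<alpha> * exp (- \<alpha> * s\<^sup>2 / 4)) *\<^sub>R A)"
    unfolding e_def[symmetric]
  proof (rule bigO_from_componentwise[OF _ C])
    fix s j assume s: "s \<ge> s0 c0"
    have "\<bar>n s $ j - (sqrt (1 - (A' j)\<^sup>2) * sin (a' j + \<Psi> s)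
        + 2 * (c0 * e s) * (1 / s) * \<alpha> * A' j)\<bar> \<le> 1200 * k ^ 9 * \<bar>e s / s\<^sup>2\<bar>"
      using n[OF s, of j] gauge[OF s, of 220 7 2] by simp
    then show "\<bar>n s $ j - (Bplus A * vsin (phase c0 \<alpha> a s) + (2 * c0 / s) *\<^sub>R (\<alpha> * e s) *\<^sub>R A) $ j\<bar>
        \<le> 1200 * k ^ 9 * \<bar>e s / s\<^sup>2\<bar>"
      by (simp add: Bplus_def vsin_def phase[OF s] A_def mult_ac)
  qed
  moreover have "bigO_from C (s0 c0) (\<lambda>s. exp (- \<alpha> * s\<^sup>2 / 4) / s\<^sup>2) b
             (\<lambda>s. Bplus A * vcos (phase c0 \<alpha> a s)
                + (2 * c0 / s) *\<^sub>R (beta \<alpha> * exp (- \<alpha> * s\<^sup>2 / 4)) *\<^sub>R A)"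
    unfolding e_def[symmetric]
  proof (rule bigO_from_componentwise[OF _ C])
    fix s j assume s: "s \<ge> s0 c0"
    have "\<bar>b s $ j - (sqrt (1 - (A' j)\<^sup>2) * cos (a' j + \<Psi> s)
        + 2 * (c0 * e s) * (1 / s) * beta \<alpha> * A' j)\<bar> \<le> 1200 * k ^ 9 * \<bar>e s / s\<^sup>2\<bar>"
      using b[OF s, of j] gauge[OF s, of 220 7 2] by simp
    then show "\<bar>b s $ j - (Bplus A * vcos (phase c0 \<alpha> a s) + (2 * c0 / s) *\<^sub>R (beta \<alpha> * e s) *\<^sub>R A) $ j\<bar>
        \<le> 1200 * k ^ 9 * \<bar>e s / s\<^sup>2\<bar>"
      by (simp add: Bplus_def vcos_def phase[OF s] A_def mult_ac)
  qed
  moreover have "A \<in> sphere 0 1" "\<forall>j. a $ j \<in> {0..<2 * pi}"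
    using \<open>norm A = 1\<close> row by (auto simp: a_def)
  ultimately show ?thesis by blast
qed

theorem theorem1p2:
  fixes c0 :: real
  assumes "c0 > 0"
  shows
    "(\<forall>\<alpha>\<in>{0..1}. \<forall>m n b. profile_solution c0 \<alpha> m n b \<longrightarrow>
        even_fun (\<lambda>s. m s $ 1) \<and> (\<forall>j\<in>{2, 3}. odd_fun (\<lambda>s. m s $ j)) \<and>
        odd_fun (\<lambda>s. n s $ 1) \<and> odd_fun (\<lambda>s. b s $ 1) \<and>
        (\<forall>j\<in>{2, 3}. even_fun (\<lambda>s. n s $ j) \<and> even_fun (\<lambda>s. b s $ j)))
     \<and>
     (\<exists>C>0. \<forall>\<alpha>\<in>{0..1}. \<forall>m n b. profile_solution c0 \<alpha> m n b \<longrightarrow>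
        (\<exists>A\<in>sphere 0 1. \<exists>B a. (\<forall>j. a $ j \<in> {0..<2 * pi}) \<and> B = Bplus A \<and>
           bigO_from C (s0 c0) (\<lambda>s. exp (- \<alpha> * s\<^sup>2 / 4) / s ^ 3) m
             (\<lambda>s. A
                - (2 * c0 / s) *\<^sub>R exp (- \<alpha> * s\<^sup>2 / 4) *\<^sub>R
                    (B * (\<alpha> *\<^sub>R vsin (phase c0 \<alpha> a s) + beta \<alpha> *\<^sub>R vcos (phase c0 \<alpha> a s)))
                - (2 * c0\<^sup>2 / s\<^sup>2) *\<^sub>R exp (- \<alpha> * s\<^sup>2 / 2) *\<^sub>R A) \<and>
           bigO_from C (s0 c0) (\<lambda>s. exp (- \<alpha> * s\<^sup>2 / 4) / s\<^sup>2) n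
             (\<lambda>s. B * vsin (phase c0 \<alpha> a s)
                + (2 * c0 / s) *\<^sub>R (\<alpha> * exp (- \<alpha> * s\<^sup>2 / 4)) *\<^sub>R A) \<and>
           bigO_from C (s0 c0) (\<lambda>s. exp (- \<alpha> * s\<^sup>2 / 4) / s\<^sup>2) b
             (\<lambda>s. B * vcos (phase c0 \<alpha> a s)
                + (2 * c0 / s) *\<^sub>R (beta \<alpha> * exp (- \<alpha> * s\<^sup>2 / 4)) *\<^sub>R A)))"
proof (rule conjI, goal_cases)
  case 1
  show ?case using profile_symmetries by blast
next
  case 2
  have pos: "3600 * (1 + c0) ^ 9 > 0" using assms by simp
  show ?case
    by (rule exI, rule conjI[OF pos], intro ballI allI impI, rule profile_asymptotics[OF _ assms])
      auto
qed

end
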